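(* (1) (Global t'Hooft ansatz) There is a unique map $$\phi:\Gamma(Gr,\widetilde{\varepsilon[-1]})^*\to\mathcal{A}(\mathcal{P})$$ which in local coordinates is given by the local t'Hooft ansatz, i.e. such that for every $s\in\Gamma(Gr,\widetilde{\varepsilon[-1]})^*$ and every $g\in SL(4,\mathbb{R})$, if $s$ is represented by the function $f_g$ in the trivialization over the chart $U_g$, then $\phi(s)$ has connection potential $A(f_g)=-\frac{1}{f_g}\frac{\partial f_g}{\partial X}\,dX$ in the standard frame of $\mathcal{P}$ over $U_g$. Here $\Gamma(Gr,\widetilde{\varepsilon[-1]})^*$ is the space of nowhere vanishing smooth sections of $\widetilde{\varepsilon[-1]}$ and $\mathcal{A}(\mathcal{P})$ is the space of connections on $\mathcal{P}$. (2) For $s\in\Gamma(Gr,\widetilde{\varepsilon[-1]})^*$, the curvature of $\phi(s)$ is anti-self-dual if and only if $\square_{2,2}s=0$.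
   Context: $Gr=Gr(2,\mathbb{R}^4)$ is the Grassmannian of real 2-planes in $\mathbb{R}^4$. For $g=\begin{pmatrix} g_{11} & g_{12} \\ g_{21} & g_{22} \end{pmatrix}\in SL(4,\mathbb{R})$ with $2\times2$ blocks, the chart $\Psi_g:M_2(\mathbb{R})\to Gr$ sends $X=(x_{ij})$ to the column span of $g\begin{pmatrix} X \\ I \end{pmatrix}$; $U_g=\Psi_g(M_2(\mathbb{R}))$. With $h^{-1}g=\begin{pmatrix} k_{11} & k_{12} \\ k_{21} & k_{22} \end{pmatrix}$, the change of coordinates from $U_g$ to $U_h$ is $\Psi_{g,h}(X)=(k_{11}X+k_{12})(k_{21}X+k_{22})^{-1}$, defined where $\det(k_{21}X+k_{22})\neq0$. $\mathcal{P}$ is the universal (tautological) rank-2 bundle on $Gr$, whose fibre at $p$ is the plane $p$. Over $U_g$ it has the standard frame given by the columns of $g\begin{pmatrix} X \\ I \end{pmatrix}$, with transition functions $k_{21}X+k_{22}$ (coordinates $v_h=(k_{21}X+k_{22})v_g$). $\varepsilon[-1]=\wedge^2\mathcal{P}$, with transition functions $\det(k_{21}X+k_{22})$, and $\varepsilon[n]=\varepsilon[-1]^{-n}$. $\tilde\varepsilon$ is the line bundle with transition functions $\det(k_{21}X+k_{22})/|\det(k_{21}X+k_{22})|$, and $\widetilde{E}=E\otimes\tilde\varepsilon$. Thus a section $s$ of $\widetilde{\varepsilon[-1]}$ is a family of functions $f_g$ on $M_2(\mathbb{R})$ with $f_h\circ\Psi_{g,h}=|\det(k_{21}X+k_{22})|\,f_g$.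 For a function $f$ of $X$, $\frac{\partial f}{\partial X}=\begin{pmatrix} \frac{\partial f}{\partial x_{11}} & \frac{\partial f}{\partial x_{21}} \\ \frac{\partial f}{\partial x_{12}} & \frac{\partial f}{\partial x_{22}} \end{pmatrix}$ and $dX=\begin{pmatrix} dx_{11} & dx_{12} \\ dx_{21} & dx_{22} \end{pmatrix}$. The local t'Hooft ansatz is $A(f)=-\frac{1}{f}\frac{\partial f}{\partial X}dX$, an $M_2(\mathbb{R})$-valued 1-form. A connection with potential $A$ in a frame $u$ satisfies $\nabla(uv)=u(dv+Av)$ and has curvature $F=dA+A\wedge A$. $\square_{2,2}=\frac{\partial^2}{\partial x_{11}\partial x_{22}}-\frac{\partial^2}{\partial x_{12}\partial x_{21}}$ on each chart; these local operators define a global differential operator $\square_{2,2}:\Gamma(Gr,\widetilde{\varepsilon[-1]})\to\Gamma(Gr,\widetilde{\varepsilon[-3]})$. $Gr$ carries the conformal structure and orientation given on each chart by $ds^2=2(dx_{11}dx_{22}-dx_{12}dx_{21})$ and $dx_{11}\wedge dx_{21}\wedge dx_{12}\wedge dx_{22}$. A 2-form $\omega$ is anti-self-dual if $*\omega=-\omega$; on each chart the anti-self-dual 2-forms are spanned by $dx_{11}\wedge dx_{12}$, $dx_{21}\wedge dx_{22}$, $dx_{11}\wedge dx_{22}-dx_{12}\wedge dx_{21}$. *)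

theory Defs
  imports "HOL-Analysis.Analysis"
begin

section \<open>Smooth maps\<close>

text \<open>\<open>C_k\<close>-maps on a whole (finite-dimensional) space via iterated directional derivatives;
  all charts below are parametrised by the full space of \<open>2 \<times> 2\<close> matrices.\<close>

primrec Ck :: "nat \<Rightarrow> ('a::euclidean_space \<Rightarrow> 'b::real_normed_vector) \<Rightarrow> bool" where
  "Ck 0 f \<longleftrightarrow> continuous_on UNIV f"
| "Ck (Suc k) f \<longleftrightarrow> (\<forall>x. f differentiable (at x)) \<and>
     (\<forall>v. Ck k (\<lambda>x. frechet_derivative f (at x) v))"

definition smooth :: "('a::euclidean_space \<Rightarrow> 'b::real_normed_vector) \<Rightarrow> bool" where
  "smooth f \<longleftrightarrow> (\<forall>k. Ck k f)"


section \<open>The Grassmannian and its charts\<close>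

type_synonym mat2 = "real^2^2"
type_synonym mat4 = "real^4^4"

definition Gr :: "(real^4) set set" where
  "Gr = {p. subspace p \<and> dim p = 2}"

definition SL4 :: "mat4 set" where
  "SL4 = {g. det g = 1}"

text \<open>\<open>stack X Y\<close> is the \<open>4 \<times> 2\<close> matrix with \<open>X\<close> on top of \<open>Y\<close>.\<close>

definition stack :: "mat2 \<Rightarrow> mat2 \<Rightarrow> real^2^4" where
  "stack X Y = vector [X$1, X$2, Y$1, Y$2]"

definition blk11 :: "mat4 \<Rightarrow> mat2" where
  "blk11 k = vector [vector [k$1$1, k$1$2], vector [k$2$1, k$2$2]]"
definition blk12 :: "mat4 \<Rightarrow> mat2" where
  "blk12 k = vector [vector [k$1$3, k$1$4], vector [k$2$3, k$2$4]]"
definition blk21 :: "mat4 \<Rightarrow> mat2" where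
  "blk21 k = vector [vector [k$3$1, k$3$2], vector [k$4$1, k$4$2]]"
definition blk22 :: "mat4 \<Rightarrow> mat2" where
  "blk22 k = vector [vector [k$3$3, k$3$4], vector [k$4$3, k$4$4]]"

text \<open>The columns of \<open>frame g X\<close> are the standard frame of the tautological bundle
  at the point \<open>chart g X\<close>.\<close>

definition frame :: "mat4 \<Rightarrow> mat2 \<Rightarrow> real^2^4" where
  "frame g X = g ** stack X (mat 1)"

definition chart :: "mat4 \<Rightarrow> mat2 \<Rightarrow> (real^4) set" where
  "chart g X = span (columns (frame g X))"

text \<open>\<open>J g h X\<close> is the matrix \<open>k\<^sub>2\<^sub>1 X + k\<^sub>2\<^sub>2\<close> for \<open>k = h\<inverse> g\<close>, and \<open>trans_map g h\<close> is the change of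
  coordinates from the \<open>g\<close>-chart to the \<open>h\<close>-chart, meaningful where \<open>det (J g h X) \<noteq> 0\<close>.\<close>

definition J :: "mat4 \<Rightarrow> mat4 \<Rightarrow> mat2 \<Rightarrow> mat2" where
  "J g h X = (let k = matrix_inv h ** g in blk21 k ** X + blk22 k)"

definition trans_map :: "mat4 \<Rightarrow> mat4 \<Rightarrow> mat2 \<Rightarrow> mat2" where
  "trans_map g h X =
     (let k = matrix_inv h ** g in (blk11 k ** X + blk12 k) ** matrix_inv (J g h X))"


section \<open>Sections of the twisted line bundles\<close>

text \<open>Sections of \<open>\<epsilon>[n]\<close> (transition functions \<open>det(J)\<^sup>-\<^sup>n\<close>) tensored with the sign bundle
  (transition functions \<open>det J / |det J|\<close>), as families of local representatives.  Families are
  extensional, i.e. \<open>undefined\<close> outside \<open>SL4\<close>, so that equality of families is equality of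
  sections.\<close>

definition twisted_sections :: "int \<Rightarrow> (mat4 \<Rightarrow> mat2 \<Rightarrow> real) set" where
  "twisted_sections n = {f \<in> SL4 \<rightarrow>\<^sub>E {u. smooth u}.
     \<forall>g\<in>SL4. \<forall>h\<in>SL4. \<forall>X. det (J g h X) \<noteq> 0 \<longrightarrow>
       f h (trans_map g h X) = (det (J g h X) powi (- n) * sgn (det (J g h X))) * f g X}"

text \<open>For \<open>n = -1\<close> the transition function is \<open>|det J|\<close>.\<close>

lemma twisted_sections_minus_one:
  "f \<in> twisted_sections (-1) \<longleftrightarrow> f \<in> SL4 \<rightarrow>\<^sub>E {u. smooth u} \<and>
     (\<forall>g\<in>SL4. \<forall>h\<in>SL4. \<forall>X. det (J g h X) \<noteq> 0 \<longrightarrow>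
       f h (trans_map g h X) = \<bar>det (J g h X)\<bar> * f g X)"
  by (auto simp: twisted_sections_def abs_sgn)

definition nonvanishing_sections :: "(mat4 \<Rightarrow> mat2 \<Rightarrow> real) set" where
  "nonvanishing_sections = {f \<in> twisted_sections (-1). \<forall>g\<in>SL4. \<forall>X. f g X \<noteq> 0}"


section \<open>Connections on the tautological bundle\<close>

definition smooth_functions :: "((real^4) set \<Rightarrow> real) set" where
  "smooth_functions = {u. \<forall>g\<in>SL4. smooth (\<lambda>X. u (chart g X))}"

text \<open>A map \<open>w\<close> with \<open>w X \<in> chart g X\<close> whose coordinates in the standard frame are smooth.\<close>

definition smooth_in_frame :: "mat4 \<Rightarrow> (mat2 \<Rightarrow> real^4) \<Rightarrow> bool" where
  "smooth_in_frame g w \<longleftrightarrow> (\<exists>v::mat2 \<Rightarrow> real^2. smooth v \<and> (\<forall>X. w X = frame g X *v v X))"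

definition sections_P :: "((real^4) set \<Rightarrow> real^4) set" where
  "sections_P = {\<sigma> \<in> (\<Pi>\<^sub>E p\<in>Gr. p). \<forall>g\<in>SL4. smooth_in_frame g (\<lambda>X. \<sigma> (chart g X))}"

text \<open>Smooth 1-forms with values in the tautological bundle: \<open>\<omega> g X Y\<close> is the value, in the plane
  \<open>chart g X\<close>, on the tangent vector with coordinates \<open>Y\<close> in the \<open>g\<close>-chart.\<close>

definition one_forms_P :: "(mat4 \<Rightarrow> mat2 \<Rightarrow> mat2 \<Rightarrow> real^4) set" where
  "one_forms_P = {\<omega> \<in> extensional SL4.
     (\<forall>g\<in>SL4. (\<forall>X. linear (\<omega> g X)) \<and> (\<forall>Y. smooth_in_frame g (\<lambda>X. \<omega> g X Y))) \<and>
     (\<forall>g\<in>SL4. \<forall>h\<in>SL4. \<forall>X. det (J g h X) \<noteq> 0 \<longrightarrow>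
       (\<forall>Y. \<omega> h (trans_map g h X) (frechet_derivative (trans_map g h) (at X) Y) = \<omega> g X Y))}"

type_synonym connection = "((real^4) set \<Rightarrow> real^4) \<Rightarrow> mat4 \<Rightarrow> mat2 \<Rightarrow> mat2 \<Rightarrow> real^4"

text \<open>A connection is a covariant derivative from sections to bundle-valued 1-forms: additive
  and satisfying the Leibniz rule \<open>\<nabla>(u \<sigma>) = du \<otimes> \<sigma> + u \<nabla>\<sigma>\<close> (homogeneity over the reals is the
  Leibniz rule for constant \<open>u\<close>).\<close>

definition connections_P :: "connection set" where
  "connections_P = {D \<in> sections_P \<rightarrow>\<^sub>E one_forms_P.
     (\<forall>\<sigma>\<in>sections_P. \<forall>\<tau>\<in>sections_P. \<forall>g\<in>SL4. \<forall>X Y.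
        D (\<lambda>p\<in>Gr. \<sigma> p + \<tau> p) g X Y = D \<sigma> g X Y + D \<tau> g X Y) \<and>
     (\<forall>u\<in>smooth_functions. \<forall>\<sigma>\<in>sections_P. \<forall>g\<in>SL4. \<forall>X Y.
        D (\<lambda>p\<in>Gr. u p *\<^sub>R \<sigma> p) g X Y =
          frechet_derivative (\<lambda>Z. u (chart g Z)) (at X) Y *\<^sub>R \<sigma> (chart g X)
          + u (chart g X) *\<^sub>R D \<sigma> g X Y)}"

text \<open>Matrix-valued 1-forms on a chart: \<open>A X Y\<close> is the value at \<open>X\<close> on the tangent vector \<open>Y\<close>.\<close>

definition matrix_one_form :: "(mat2 \<Rightarrow> mat2 \<Rightarrow> mat2) \<Rightarrow> bool" where
  "matrix_one_form A \<longleftrightarrow> (\<forall>X. linear (A X)) \<and> (\<forall>Y. smooth (\<lambda>X. A X Y))"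

text \<open>\<open>\<nabla>(u v) = u (dv + A v)\<close> in the standard frame \<open>u = frame g\<close>.  The sections \<open>u v\<close> are taken to
  be restrictions of global ones; their values and derivatives at a point are arbitrary.\<close>

definition has_potential :: "connection \<Rightarrow> mat4 \<Rightarrow> (mat2 \<Rightarrow> mat2 \<Rightarrow> mat2) \<Rightarrow> bool" where
  "has_potential D g A \<longleftrightarrow> matrix_one_form A \<and>
     (\<forall>\<sigma>\<in>sections_P. \<forall>v::mat2 \<Rightarrow> real^2. (\<forall>X. \<sigma> (chart g X) = frame g X *v v X) \<longrightarrow>
       (\<forall>X Y. D \<sigma> g X Y = frame g X *v (frechet_derivative v (at X) Y + A X Y *v v X)))"

text \<open>\<open>F = dA + A \<and> A\<close>, evaluated at \<open>X\<close> on the tangent vectors \<open>U\<close>, \<open>V\<close>.\<close>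

definition curvature_form ::
    "(mat2 \<Rightarrow> mat2 \<Rightarrow> mat2) \<Rightarrow> mat2 \<Rightarrow> mat2 \<Rightarrow> mat2 \<Rightarrow> mat2" where
  "curvature_form A X U V =
     (frechet_derivative (\<lambda>Z. A Z V) (at X) U - frechet_derivative (\<lambda>Z. A Z U) (at X) V)
     + (A X U ** A X V - A X V ** A X U)"

text \<open>\<open>curvature D g\<close> is the curvature in the standard frame over the \<open>g\<close>-chart, computed from
  the (unique) potential of \<open>D\<close> there.\<close>

definition curvature :: "connection \<Rightarrow> mat4 \<Rightarrow> mat2 \<Rightarrow> mat2 \<Rightarrow> mat2 \<Rightarrow> mat2" where
  "curvature D g = curvature_form (THE A. has_potential D g A)"


section \<open>Anti-self-duality\<close>

text \<open>The polarisation of \<open>ds\<^sup>2 = 2 (dx\<^sub>1\<^sub>1 dx\<^sub>2\<^sub>2 - dx\<^sub>1\<^sub>2 dx\<^sub>2\<^sub>1)\<close>.\<close>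

definition metric :: "mat2 \<Rightarrow> mat2 \<Rightarrow> real" where
  "metric U V = U$1$1 * V$2$2 + U$2$2 * V$1$1 - U$1$2 * V$2$1 - U$2$1 * V$1$2"

text \<open>The volume form \<open>dx\<^sub>1\<^sub>1 \<and> dx\<^sub>2\<^sub>1 \<and> dx\<^sub>1\<^sub>2 \<and> dx\<^sub>2\<^sub>2\<close>; it is the oriented unit volume form of
  \<open>metric\<close>, whose Gram determinant in these coordinates is \<open>1\<close>.\<close>

definition coords :: "mat2 \<Rightarrow> real^4" where
  "coords U = vector [U$1$1, U$2$1, U$1$2, U$2$2]"

definition vol :: "mat2 \<Rightarrow> mat2 \<Rightarrow> mat2 \<Rightarrow> mat2 \<Rightarrow> real" where
  "vol S T U V = det (vector [coords S, coords T, coords U, coords V] :: mat4)"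

text \<open>The vector metrically dual to the coordinate covector \<open>a \<bullet> _\<close>.\<close>

definition sharp :: "mat2 \<Rightarrow> mat2" where
  "sharp a = (THE W. \<forall>V. metric W V = a \<bullet> V)"

text \<open>The index formula \<open>(*\<omega>)\<^sub>c\<^sub>d = \<epsilon>\<^sub>a\<^sub>b\<^sub>c\<^sub>d \<omega>\<^sup>a\<^sup>b / 2\<close>, with indices raised by \<open>metric\<close>.\<close>

definition hodge :: "(mat2 \<Rightarrow> mat2 \<Rightarrow> 'b::real_vector) \<Rightarrow> mat2 \<Rightarrow> mat2 \<Rightarrow> 'b" where
  "hodge \<omega> U V =
     (1/2) *\<^sub>R (\<Sum>a\<in>Basis. \<Sum>b\<in>Basis. vol a b U V *\<^sub>R \<omega> (sharp a) (sharp b))"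

definition anti_self_dual :: "(mat4 \<Rightarrow> mat2 \<Rightarrow> mat2 \<Rightarrow> mat2 \<Rightarrow> mat2) \<Rightarrow> bool" where
  "anti_self_dual F \<longleftrightarrow> (\<forall>g\<in>SL4. \<forall>X U V. hodge (F g X) U V = - F g X U V)"


section \<open>The t'Hooft ansatz and the ultrahyperbolic operator\<close>

definition partial :: "2 \<Rightarrow> 2 \<Rightarrow> (mat2 \<Rightarrow> real) \<Rightarrow> mat2 \<Rightarrow> real" where
  "partial i j f X = frechet_derivative f (at X) (axis i (axis j 1))"

text \<open>Note the transposition: the \<open>(i,j)\<close> entry is the derivative with respect to \<open>x\<^sub>j\<^sub>i\<close>.\<close>

definition dX_grad :: "(mat2 \<Rightarrow> real) \<Rightarrow> mat2 \<Rightarrow> mat2" where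
  "dX_grad f X = (\<chi> i j. partial j i f X)"

definition tHooft :: "(mat2 \<Rightarrow> real) \<Rightarrow> mat2 \<Rightarrow> mat2 \<Rightarrow> mat2" where
  "tHooft f X Y = (- 1 / f X) *\<^sub>R (dX_grad f X ** Y)"

definition box_local :: "(mat2 \<Rightarrow> real) \<Rightarrow> mat2 \<Rightarrow> real" where
  "box_local f X = partial 1 1 (partial 2 2 f) X - partial 1 2 (partial 2 1 f) X"

definition box22 :: "(mat4 \<Rightarrow> mat2 \<Rightarrow> real) \<Rightarrow> mat4 \<Rightarrow> mat2 \<Rightarrow> real" where
  "box22 s = (\<lambda>g\<in>SL4. box_local (s g))"

definition zero_section :: "mat4 \<Rightarrow> mat2 \<Rightarrow> real" where
  "zero_section = (\<lambda>g\<in>SL4. \<lambda>X. 0)"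

definition global_tHooft_map :: "((mat4 \<Rightarrow> mat2 \<Rightarrow> real) \<Rightarrow> connection) \<Rightarrow> bool" where
  "global_tHooft_map \<phi> \<longleftrightarrow> \<phi> \<in> nonvanishing_sections \<rightarrow>\<^sub>E connections_P \<and>
     (\<forall>s\<in>nonvanishing_sections. \<forall>g\<in>SL4. has_potential (\<phi> s) g (tHooft (s g)))"

end

(* Write G for the matrix (1/f) df/dX, so that the ansatz is A = - G dX and df/f = trace (G dX).
   Let T be the change of coordinates from the g-chart to the h-chart.  Differentiating
   T (k21 X + k22) = k11 X + k12 gives dT J = (k11 - T k21) dX, and differentiating the logarithm of
   f_h o T = |det J| f_g gives, by nondegeneracy of the trace form,
   G_h (k11 - T k21) = J G_g + k21.  Together these are the gauge transformation law
   A_h(dT) J = J A_g - dJ, so the local potentials define a connection.  A potential is determined by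
   the connection because projecting constant vectors orthogonally onto the planes produces global
   smooth sections with arbitrary value at a given plane.  Finally, the self-dual part of the
   curvature is the ultrahyperbolic operator of f divided by f, times a constant tensor, because its
   part quadratic in G cancels. *)

theory Submission
  imports Defs
begin

section \<open>Calculus of smooth maps\<close>

text \<open>The weight one is what makes the ansatz transform correctly: d log |det J| = trace (J^-1
  k21 dX) contributes the term k21, and k21 dX is dJ. Had the transition function been |det J|^n,
  the gauge law would contain n dJ instead. The sign twist drops out of logarithmic derivatives. The
  quadratic cancellation has a simple source. Self-dual bivectors are spanned by products of U = a
  e^T and V = b e^T with the same row e^T. For P = df/dX this gives P U P V = trace (P V) P U and P
  V P U = trace (P U) P V, so the terms of A \<and> A cancel those obtained by differentiating 1/f.
  Three features of the definitions shape the rest. \<open>smooth\<close> speaks of maps on the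
  whole matrix space, while a change of coordinates is meaningful only where det J is nonzero; for
  the latter, differentiability at such points is what the argument uses.
  \<open>has_potential\<close> tests only global sections, so local frames cannot be inserted
  directly. \<open>curvature\<close> takes its potential by definite description, so uniqueness of
  potentials must precede any computation with it.\<close>

lemma has_frechet_derivative:
  "f differentiable (at x) \<Longrightarrow> (f has_derivative frechet_derivative f (at x)) (at x)"
  using frechet_derivative_works by blast

lemma frechet_derivative_eq:
  "(f has_derivative f') (at x) \<Longrightarrow> frechet_derivative f (at x) = f'"
  by (rule frechet_derivative_at [symmetric])

text \<open>\<open>Ck\<close> is phrased through \<open>frechet_derivative\<close>; this form lets
  the inductions below work with any explicit derivative.\<close>

lemma Ck_SucI:
  assumes "\<And>x. (f has_derivative f' x) (at x)" and "\<And>v. Ck k (\<lambda>x. f' x v)"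
  shows "Ck (Suc k) f"
proof -
  have "frechet_derivative f (at x) = f' x" for x
    using assms(1) by (rule frechet_derivative_eq)
  then show ?thesis
    using assms by (auto simp: differentiable_def)
qed

lemma Ck_Suc_has_derivative:
  "Ck (Suc k) f \<Longrightarrow> (f has_derivative frechet_derivative f (at x)) (at x)"
  by (simp add: has_frechet_derivative)

text \<open>The product rule pairs a derivative, known to order \<open>k\<close>, with an
  undifferentiated factor known to order \<open>Suc k\<close>; lowering the latter makes the
  induction for products close.\<close>

lemma Ck_Suc_imp_Ck: "Ck (Suc k) f \<Longrightarrow> Ck k f"
proof (induction k arbitrary: f)
  case 0
  then show ?case
    by (simp add: continuous_at_imp_continuous_on differentiable_imp_continuous_within)
next
  case (Suc k)
  then show ?case by (metis Ck.simps(2))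
qed

lemma Ck_const: "Ck k (\<lambda>x. c)"
proof (induction k arbitrary: c)
  case (Suc k)
  then show ?case by (intro Ck_SucI [where f' = "\<lambda>x v. 0"]) auto
qed simp

lemma Ck_bounded_linear:
  assumes "bounded_linear L" and "Ck k f"
  shows "Ck k (\<lambda>x. L (f x))"
  using assms(2)
proof (induction k arbitrary: f)
  case 0
  then show ?case
    using assms(1) by (simp add: bounded_linear.continuous_on)
next
  case (Suc k)
  show ?case
  proof (rule Ck_SucI)
    show "((\<lambda>x. L (f x)) has_derivative (\<lambda>v. L (frechet_derivative f (at x) v))) (at x)" for x
      using assms(1) Ck_Suc_has_derivative [OF Suc.prems]
      by (rule bounded_linear.has_derivative)
    show "Ck k (\<lambda>x. L (frechet_derivative f (at x) v))" for v
      using Suc by simp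
  qed
qed

lemma Ck_add:
  assumes "Ck k f" and "Ck k g"
  shows "Ck k (\<lambda>x. f x + g x)"
  using assms
proof (induction k arbitrary: f g)
  case 0
  then show ?case by (simp add: continuous_on_add)
next
  case (Suc k)
  show ?case
  proof (rule Ck_SucI)
    show "((\<lambda>x. f x + g x) has_derivative
        (\<lambda>v. frechet_derivative f (at x) v + frechet_derivative g (at x) v)) (at x)" for x
      by (intro has_derivative_add Ck_Suc_has_derivative [OF Suc.prems(1)] Ck_Suc_has_derivative [OF Suc.prems(2)])
    show "Ck k (\<lambda>x. frechet_derivative f (at x) v + frechet_derivative g (at x) v)" for v
      using Suc by simp
  qed
qed

lemma Ck_bounded_bilinear:
  assumes "bounded_bilinear B" and "Ck k f" and "Ck k g"
  shows "Ck k (\<lambda>x. B (f x) (g x))"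
  using assms(2,3)
proof (induction k arbitrary: f g)
  case 0
  then show ?case
    using assms(1) by (simp add: bounded_bilinear.continuous_on)
next
  case (Suc k)
  show ?case
  proof (rule Ck_SucI)
    show "((\<lambda>x. B (f x) (g x)) has_derivative
        (\<lambda>v. B (f x) (frechet_derivative g (at x) v) + B (frechet_derivative f (at x) v) (g x))) (at x)" for x
      by (intro bounded_bilinear.FDERIV [OF assms(1)]
          Ck_Suc_has_derivative [OF Suc.prems(1)] Ck_Suc_has_derivative [OF Suc.prems(2)])
    have d: "Ck k (\<lambda>x. frechet_derivative f (at x) v)" "Ck k (\<lambda>x. frechet_derivative g (at x) v)" for v
      using Suc.prems by simp_all
    show "Ck k (\<lambda>x. B (f x) (frechet_derivative g (at x) v) + B (frechet_derivative f (at x) v) (g x))" for v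
      by (rule Ck_add [OF Suc.IH [OF Ck_Suc_imp_Ck [OF Suc.prems(1)] d(2)]
            Suc.IH [OF d(1) Ck_Suc_imp_Ck [OF Suc.prems(2)]]])
  qed
qed

text \<open>The derivative - f'/f^2 is again built from 1/f and f', so the induction hypothesis for
  1/f and the product rule suffice.\<close>

lemma Ck_inverse:
  fixes f :: "'a::euclidean_space \<Rightarrow> real"
  assumes "\<And>x. f x \<noteq> 0" and "Ck k f"
  shows "Ck k (\<lambda>x. inverse (f x))"
  using assms(2)
proof (induction k)
  case 0
  then show ?case using assms(1) by (simp add: continuous_on_inverse)
next
  case (Suc k)
  show ?case
  proof (rule Ck_SucI)
    show "((\<lambda>x. inverse (f x)) has_derivative
        (\<lambda>v. - (inverse (f x) * frechet_derivative f (at x) v * inverse (f x)))) (at x)" for x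
      by (intro Deriv.has_derivative_inverse Ck_Suc_has_derivative [OF Suc.prems] assms(1))
    show "Ck k (\<lambda>x. - (inverse (f x) * frechet_derivative f (at x) v * inverse (f x)))" for v
    proof -
      have "Ck k (\<lambda>x. inverse (f x))" using Suc Ck_Suc_imp_Ck by blast
      moreover have "Ck k (\<lambda>x. frechet_derivative f (at x) v)" using Suc.prems by simp
      ultimately have "Ck k (\<lambda>x. inverse (f x) * frechet_derivative f (at x) v * inverse (f x))"
        by (intro Ck_bounded_bilinear [OF bounded_bilinear_mult])
      then show ?thesis
        by (rule Ck_bounded_linear [OF bounded_linear_minus [OF bounded_linear_ident]])
    qed
  qed
qed

lemma Ck_linear:
  assumes "bounded_linear L"
  shows "Ck k L"
proof (cases k)
  case 0
  then show ?thesis using assms by (simp add: linear_continuous_on)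
next
  case (Suc k)
  show ?thesis unfolding Suc
    by (rule Ck_SucI [OF bounded_linear_imp_has_derivative [OF assms] Ck_const])
qed

lemma smooth_Ck: "smooth f \<Longrightarrow> Ck k f"
  unfolding smooth_def by (rule spec)

lemma smooth_has_derivative:
  assumes "smooth f"
  shows "(f has_derivative frechet_derivative f (at x)) (at x)"
  by (rule Ck_Suc_has_derivative [OF smooth_Ck [OF assms, of "Suc 0"]])

lemma smooth_differentiable: "smooth f \<Longrightarrow> f differentiable (at x)"
  unfolding differentiable_def by (rule exI, rule smooth_has_derivative)

lemma smooth_frechet_derivative:
  assumes "smooth f"
  shows "smooth (\<lambda>x. frechet_derivative f (at x) v)"
  unfolding smooth_def
proof
  show "Ck k (\<lambda>x. frechet_derivative f (at x) v)" for k
    using smooth_Ck [OF assms, of "Suc k"] by simp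
qed

lemma linear_frechet_derivative_smooth: "smooth f \<Longrightarrow> linear (frechet_derivative f (at x))"
  by (rule linear_frechet_derivative [OF smooth_differentiable])

lemma smooth_const: "smooth (\<lambda>x. c)"
  unfolding smooth_def using Ck_const by (rule allI)

lemma smooth_bounded_linear: "bounded_linear L \<Longrightarrow> smooth f \<Longrightarrow> smooth (\<lambda>x. L (f x))"
  by (simp add: smooth_def Ck_bounded_linear)

lemma smooth_linear: "bounded_linear L \<Longrightarrow> smooth L"
  unfolding smooth_def by (intro allI Ck_linear)

lemma smooth_add: "smooth f \<Longrightarrow> smooth g \<Longrightarrow> smooth (\<lambda>x. f x + g x)"
  by (simp add: smooth_def Ck_add)

lemma smooth_bounded_bilinear:
  "bounded_bilinear B \<Longrightarrow> smooth f \<Longrightarrow> smooth g \<Longrightarrow> smooth (\<lambda>x. B (f x) (g x))"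
  by (simp add: smooth_def Ck_bounded_bilinear)

lemma smooth_inverse:
  fixes f :: "'a::euclidean_space \<Rightarrow> real"
  shows "(\<And>x. f x \<noteq> 0) \<Longrightarrow> smooth f \<Longrightarrow> smooth (\<lambda>x. inverse (f x))"
  by (simp add: smooth_def Ck_inverse)

lemma smooth_continuous: "smooth f \<Longrightarrow> isCont f x"
  by (rule has_derivative_continuous [OF smooth_has_derivative])

section \<open>Symmetry of second derivatives\<close>

lemma smooth_imp_second_difference:
  fixes f :: "'a::euclidean_space \<Rightarrow> real"
  assumes "smooth f" and "h > 0"
  shows "\<exists>s t. 0 < s \<and> s < h \<and> 0 < t \<and> t < h \<and>
    f (x + h *\<^sub>R u + h *\<^sub>R v) - f (x + h *\<^sub>R u) - f (x + h *\<^sub>R v) + f x =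
      h\<^sup>2 * frechet_derivative (\<lambda>z. frechet_derivative f (at z) u) (at (x + s *\<^sub>R u + t *\<^sub>R v)) v"
proof -
  let ?fu = "\<lambda>z. frechet_derivative f (at z) u"
  have line: "((\<lambda>s. F (a + s *\<^sub>R w)) has_real_derivative frechet_derivative F (at (a + s *\<^sub>R w)) w) (at s)"
    if "smooth F" for F :: "'a \<Rightarrow> real" and a w s
  proof -
    have "((\<lambda>s. F (a + s *\<^sub>R w)) has_derivative
        (\<lambda>r. frechet_derivative F (at (a + s *\<^sub>R w)) (r *\<^sub>R w))) (at s)"
      by (rule has_derivative_compose [OF _ smooth_has_derivative [OF that]])
        (auto intro!: derivative_eq_intros)
    then show ?thesis
      by (simp only: linear_scale [OF linear_frechet_derivative_smooth [OF that]] real_scaleR_def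
          has_field_derivative_def mult_commute_abs)
  qed
  \<comment> \<open>The second difference is the increment of \<open>?phi\<close>. One mean value
    theorem along \<open>u\<close> turns it into \<open>h\<close> times an increment of
    \<open>?fu\<close> along \<open>v\<close>, and a second one along \<open>v\<close> yields the
    other factor \<open>h\<close>.\<close>
  let ?phi = "\<lambda>s. f ((x + h *\<^sub>R v) + s *\<^sub>R u) - f (x + s *\<^sub>R u)"
  have "\<exists>s. 0 < s \<and> s < h \<and> ?phi h - ?phi 0 =
      (h - 0) * (?fu ((x + h *\<^sub>R v) + s *\<^sub>R u) - ?fu (x + s *\<^sub>R u))"
    by (rule MVT2 [OF assms(2)]) (intro DERIV_diff line assms(1))
  then obtain s where s: "0 < s" "s < h"
    "?phi h - ?phi 0 = h * (?fu ((x + h *\<^sub>R v) + s *\<^sub>R u) - ?fu (x + s *\<^sub>R u))" by auto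
  have "\<exists>t. 0 < t \<and> t < h \<and> ?fu ((x + s *\<^sub>R u) + h *\<^sub>R v) - ?fu ((x + s *\<^sub>R u) + 0 *\<^sub>R v) =
      (h - 0) * frechet_derivative ?fu (at ((x + s *\<^sub>R u) + t *\<^sub>R v)) v"
    by (rule MVT2 [OF assms(2)]) (intro line smooth_frechet_derivative assms(1))
  then obtain t where t: "0 < t" "t < h" "?fu ((x + s *\<^sub>R u) + h *\<^sub>R v) - ?fu (x + s *\<^sub>R u) =
      h * frechet_derivative ?fu (at ((x + s *\<^sub>R u) + t *\<^sub>R v)) v" by auto
  have "f (x + h *\<^sub>R u + h *\<^sub>R v) - f (x + h *\<^sub>R u) - f (x + h *\<^sub>R v) + f x = ?phi h - ?phi 0"
    by (simp add: ac_simps)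
  also have "\<dots> = h * (?fu ((x + s *\<^sub>R u) + h *\<^sub>R v) - ?fu (x + s *\<^sub>R u))"
    using s(3) by (simp add: ac_simps)
  also have "\<dots> = h\<^sup>2 * frechet_derivative ?fu (at (x + s *\<^sub>R u + t *\<^sub>R v)) v"
    using t(3) by (simp add: power2_eq_square)
  finally show ?thesis using s t by blast
qed

text \<open>The second difference is symmetric in \<open>u\<close> and \<open>v\<close>. Hence, for
  each step size, one mixed derivative at a point near \<open>x\<close> equals the other one at
  another such point; as the step shrinks both points tend to \<open>x\<close>, and continuity of
  second derivatives gives equality there.\<close>

lemma frechet_derivative_commute:
  fixes f :: "'a::euclidean_space \<Rightarrow> real"
  assumes "smooth f"
  shows "frechet_derivative (\<lambda>z. frechet_derivative f (at z) u) (at x) v =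
    frechet_derivative (\<lambda>z. frechet_derivative f (at z) v) (at x) u"
proof -
  define D where "D u v x = frechet_derivative (\<lambda>z. frechet_derivative f (at z) u) (at x) v" for u v x
  have cont: "isCont (D u v) x" for u v
    unfolding D_def by (intro smooth_continuous smooth_frechet_derivative assms)
  define h where "h n = inverse (real (Suc n))" for n
  have h: "h n > 0" for n by (simp add: h_def)
  have h0: "h \<longlonglongrightarrow> 0" unfolding h_def by (rule LIMSEQ_inverse_real_of_nat)
  have "\<exists>s t s' t'. (0 < s \<and> s < h n) \<and> (0 < t \<and> t < h n) \<and> (0 < s' \<and> s' < h n) \<and> (0 < t' \<and> t' < h n) \<and>
      D u v (x + s *\<^sub>R u + t *\<^sub>R v) = D v u (x + s' *\<^sub>R v + t' *\<^sub>R u)" for n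
  proof -
    obtain s t where st: "0 < s" "s < h n" "0 < t" "t < h n"
      "f (x + h n *\<^sub>R u + h n *\<^sub>R v) - f (x + h n *\<^sub>R u) - f (x + h n *\<^sub>R v) + f x =
        (h n)\<^sup>2 * D u v (x + s *\<^sub>R u + t *\<^sub>R v)"
      unfolding D_def using smooth_imp_second_difference [OF assms h] by blast
    obtain s' t' where st': "0 < s'" "s' < h n" "0 < t'" "t' < h n"
      "f (x + h n *\<^sub>R v + h n *\<^sub>R u) - f (x + h n *\<^sub>R v) - f (x + h n *\<^sub>R u) + f x =
        (h n)\<^sup>2 * D v u (x + s' *\<^sub>R v + t' *\<^sub>R u)"
      unfolding D_def using smooth_imp_second_difference [OF assms h] by blast
    have swap: "x + h n *\<^sub>R v + h n *\<^sub>R u = x + h n *\<^sub>R u + h n *\<^sub>R v" by simp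
    have "(h n)\<^sup>2 * D u v (x + s *\<^sub>R u + t *\<^sub>R v) = (h n)\<^sup>2 * D v u (x + s' *\<^sub>R v + t' *\<^sub>R u)"
      using st(5) st'(5) unfolding swap by linarith
    then show ?thesis using st st' h [of n] by auto
  qed
  then obtain s t s' t' where b: "\<And>n. 0 < s n \<and> s n < h n" "\<And>n. 0 < t n \<and> t n < h n"
      "\<And>n. 0 < s' n \<and> s' n < h n" "\<And>n. 0 < t' n \<and> t' n < h n"
    and eq: "\<And>n. D u v (x + s n *\<^sub>R u + t n *\<^sub>R v) = D v u (x + s' n *\<^sub>R v + t' n *\<^sub>R u)"
    by metis
  have lim0: "r \<longlonglongrightarrow> 0" if "\<And>n. 0 < r n \<and> r n < h n" for r
    by (rule tendsto_sandwich [OF _ _ tendsto_const h0]) (use that in \<open>auto intro!: always_eventually less_imp_le\<close>)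
  have lim: "(\<lambda>n. D a c (x + r n *\<^sub>R a + q n *\<^sub>R c)) \<longlonglongrightarrow> D a c x"
    if "r \<longlonglongrightarrow> 0" "q \<longlonglongrightarrow> 0" for r q a c
  proof (rule isCont_tendsto_compose [OF cont])
    have "(\<lambda>n. x + r n *\<^sub>R a + q n *\<^sub>R c) \<longlonglongrightarrow> x + 0 *\<^sub>R a + 0 *\<^sub>R c"
      by (intro tendsto_intros that)
    then show "(\<lambda>n. x + r n *\<^sub>R a + q n *\<^sub>R c) \<longlonglongrightarrow> x" by simp
  qed
  have "D u v x = D v u x"
    using lim [OF lim0 [OF b(1)] lim0 [OF b(2)], of u v] lim [OF lim0 [OF b(3)] lim0 [OF b(4)], of v u]
    by (simp add: eq LIMSEQ_unique)
  then show ?thesis by (simp add: D_def)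
qed

section \<open>Frames and coordinate changes\<close>

lemmas mat2_simps = vec_eq_iff forall_2 matrix_matrix_mult_def sum_2 mat_def

lemma vector_4 [simp]:
  "(vector [x,y,z,w] :: 'a::zero^4) $ 1 = x"
  "(vector [x,y,z,w] :: 'a::zero^4) $ 2 = y"
  "(vector [x,y,z,w] :: 'a::zero^4) $ 3 = z"
  "(vector [x,y,z,w] :: 'a::zero^4) $ 4 = w"
  unfolding vector_def by simp_all

lemma bounded_bilinear_matrix_matrix_mult:
  "bounded_bilinear ((**) :: real^'n^'m \<Rightarrow> real^'p^'n \<Rightarrow> real^'p^'m)"
  unfolding bilinear_conv_bounded_bilinear [symmetric] bilinear_def
  by (auto intro!: linearI simp: matrix_add_ldistrib matrix_matrix_mult_def vec_eq_iff sum_distrib_left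
      sum.distrib algebra_simps)

lemma matrix_matrix_mult_add_left:
  fixes A B :: "real^'n^'m" and C :: "real^'p^'n"
  shows "(A + B) ** C = A ** C + B ** C"
  by (rule bounded_bilinear.add_left [OF bounded_bilinear_matrix_matrix_mult])

lemma bounded_bilinear_matrix_vector_mult:
  "bounded_bilinear ((*v) :: real^'n^'m \<Rightarrow> real^'n \<Rightarrow> real^'m)"
  unfolding bilinear_conv_bounded_bilinear [symmetric] bilinear_def
  by (auto intro!: linearI simp: matrix_vector_mult_def vec_eq_iff sum_distrib_left
      sum.distrib algebra_simps)

lemma matrix_matrix_mult_uminus:
  fixes A :: "real^'n^'m" and B :: "real^'p^'n"
  shows "A ** (- B) = - (A ** B)" "(- A) ** B = - (A ** B)"
  by (simp_all add: matrix_matrix_mult_def vec_eq_iff sum_negf)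

lemma matrix_matrix_mult_diff:
  fixes A :: "real^'n^'m" and B :: "real^'p^'n"
  shows "A ** (B - C) = A ** B - A ** C" "(A' - A) ** B = A' ** B - A ** B"
  by (simp_all add: matrix_matrix_mult_def vec_eq_iff sum_subtractf algebra_simps)

lemma invertible_matrix_inv:
  assumes "invertible A"
  shows "A ** matrix_inv A = mat 1" "matrix_inv A ** A = mat 1"
  using assms someI_ex [of "\<lambda>A'. A ** A' = mat 1 \<and> A' ** A = mat 1"]
  unfolding invertible_def matrix_inv_def by auto

text \<open>The adjugate. It is linear in the matrix, so together with 1/det it reduces inversion of
  2 x 2 matrices to operations whose derivatives are already available.\<close>

definition adj2 :: "mat2 \<Rightarrow> mat2" where
  "adj2 M = vector [vector [M$2$2, - M$1$2], vector [- M$2$1, M$1$1]]"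

lemma bounded_linear_adj2: "bounded_linear adj2"
  unfolding linear_conv_bounded_linear [symmetric]
  by (rule linearI) (simp_all add: adj2_def mat2_simps)

lemma mult_adj2: "M ** adj2 M = det M *\<^sub>R mat 1" "adj2 M ** M = det M *\<^sub>R mat 1"
  by (simp_all add: adj2_def det_2 mat2_simps algebra_simps)

lemma matrix_inv_eq_adj2:
  assumes "det M \<noteq> 0"
  shows "matrix_inv M = inverse (det M) *\<^sub>R adj2 M"
proof -
  have "matrix_inv M = (matrix_inv M ** M) ** (inverse (det M) *\<^sub>R adj2 M)"
    unfolding matrix_mul_assoc [symmetric] using assms
    by (simp add: matrix_scalar_ac scalar_matrix_assoc [symmetric] mult_adj2)
  also have "matrix_inv M ** M = mat 1"
    using assms by (intro invertible_matrix_inv) (simp add: invertible_det_nz)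
  finally show ?thesis by simp
qed

lemma smooth_component:
  fixes M :: "'a::euclidean_space \<Rightarrow> real^'n^'m"
  shows "smooth M \<Longrightarrow> smooth (\<lambda>x. M x $ i $ j)"
  by (rule smooth_bounded_linear [OF bounded_linear_compose [OF bounded_linear_vec_nth bounded_linear_vec_nth]])

lemma smooth_matrix_mult:
  fixes M :: "'a::euclidean_space \<Rightarrow> real^'n^'m" and N :: "'a \<Rightarrow> real^'p^'n"
  shows "smooth M \<Longrightarrow> smooth N \<Longrightarrow> smooth (\<lambda>x. M x ** N x)"
  by (rule smooth_bounded_bilinear [OF bounded_bilinear_matrix_matrix_mult])

lemma smooth_matrix_vector_mult:
  fixes M :: "'a::euclidean_space \<Rightarrow> real^'n^'m"
  shows "smooth M \<Longrightarrow> smooth w \<Longrightarrow> smooth (\<lambda>x. M x *v w x)"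
  by (rule smooth_bounded_bilinear [OF bounded_bilinear_matrix_vector_mult])

lemma smooth_scaleR: "smooth c \<Longrightarrow> smooth f \<Longrightarrow> smooth (\<lambda>x. c x *\<^sub>R f x)"
  by (rule smooth_bounded_bilinear [OF bounded_bilinear_scaleR])

lemma smooth_ident: "smooth (\<lambda>x. x)"
  by (rule smooth_linear [OF bounded_linear_ident])

lemma smooth_det2:
  fixes M :: "'a::euclidean_space \<Rightarrow> mat2"
  assumes "smooth M"
  shows "smooth (\<lambda>x. det (M x))"
proof -
  have "smooth (\<lambda>x. M x $ 1 $ 1 * M x $ 2 $ 2 + - (M x $ 1 $ 2 * M x $ 2 $ 1))"
    by (intro smooth_add smooth_bounded_bilinear [OF bounded_bilinear_mult] smooth_component assms
        smooth_bounded_linear [OF bounded_linear_minus [OF bounded_linear_ident]])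
  then show ?thesis by (simp add: det_2)
qed

section \<open>Standard frames and changes of chart\<close>

lemma SL4_invertible: "g \<in> SL4 \<Longrightarrow> invertible g"
  by (simp add: SL4_def invertible_det_nz)

lemma mult_stack: "k ** stack X Y = stack (blk11 k ** X + blk12 k ** Y) (blk21 k ** X + blk22 k ** Y)"
  by (simp add: stack_def vec_eq_iff forall_4 forall_2 matrix_matrix_mult_def sum_2 sum_4
      blk11_def blk12_def blk21_def blk22_def)

lemma stack_mult: "stack X Y ** M = stack (X ** M) (Y ** M)"
  by (simp add: stack_def vec_eq_iff forall_4 forall_2 matrix_matrix_mult_def sum_2)

text \<open>The linear fractional formula with its denominator cleared: both sides are easy to
  differentiate, without the derivative of an inverse.\<close>

lemma trans_map_mult_J:
  assumes "det (J g h X) \<noteq> 0"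
  shows "trans_map g h X ** J g h X = blk11 (matrix_inv h ** g) ** X + blk12 (matrix_inv h ** g)"
  unfolding trans_map_def Let_def matrix_mul_assoc [symmetric]
  using assms by (simp add: invertible_matrix_inv invertible_det_nz)

text \<open>With k = h^-1 g, the column (X, I) is sent by k to (k11 X + k12, J) = (T, I) J, where T
  is the new coordinate; multiplying by h gives the claim. Thus J acts on coordinates of vectors
  when passing from the \<open>g\<close>-frame to the \<open>h\<close>-frame.\<close>

lemma frame_trans_map:
  assumes "h \<in> SL4" "det (J g h X) \<noteq> 0"
  shows "frame h (trans_map g h X) ** J g h X = frame g X"
proof -
  let ?k = "matrix_inv h ** g"
  have "frame h (trans_map g h X) ** J g h X = h ** stack (blk11 ?k ** X + blk12 ?k) (J g h X)"
    using trans_map_mult_J [OF assms(2)] by (simp add: frame_def stack_mult matrix_mul_assoc [symmetric])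
  also have "\<dots> = h ** (?k ** stack X (mat 1))"
    by (simp add: mult_stack J_def Let_def)
  also have "\<dots> = frame g X"
    using invertible_matrix_inv(1) [OF SL4_invertible [OF assms(1)]]
    by (simp add: frame_def matrix_mul_assoc)
  finally show ?thesis .
qed

text \<open>After removing g, the lower block of the frame is the identity matrix, so it returns
  \<open>v\<close> itself.\<close>

lemma frame_mult_eq_0:
  assumes "g \<in> SL4" "frame g X *v v = 0"
  shows "v = 0"
proof -
  have "stack X (mat 1) *v v = (matrix_inv g ** g) *v (stack X (mat 1) *v v)"
    using invertible_matrix_inv(2) [OF SL4_invertible [OF assms(1)]] by simp
  also have "\<dots> = matrix_inv g *v (frame g X *v v)"
    by (simp add: frame_def matrix_vector_mul_assoc matrix_mul_assoc)
  also have "\<dots> = 0" using assms(2) by simp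
  finally have "stack X (mat 1) *v v = 0" .
  then show ?thesis
    by (simp add: vec_eq_iff forall_4 forall_2 matrix_vector_mult_def sum_2 stack_def mat_def)
qed

lemma frame_inject:
  assumes "g \<in> SL4"
  shows "frame g X *v v = frame g X *v w \<longleftrightarrow> v = w"
  using frame_mult_eq_0 [OF assms, of X "v - w"] by (auto simp: matrix_vector_mult_diff_distrib)

lemma chart_eq_range: "chart g X = range ((*v) (frame g X))"
proof
  have "linear ((*v) (frame g X))" by simp
  then have "subspace (range ((*v) (frame g X)))"
    by (simp add: linear_subspace_image)
  moreover have "columns (frame g X) \<subseteq> range ((*v) (frame g X))"
    by (auto simp: columns_image_basis)
  ultimately show "chart g X \<subseteq> range ((*v) (frame g X))"
    unfolding chart_def by (simp add: span_minimal)
  show "range ((*v) (frame g X)) \<subseteq> chart g X"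
    unfolding chart_def using matrix_vector_mult_in_columnspace by blast
qed

lemma chart_in_Gr:
  assumes "g \<in> SL4"
  shows "chart g X \<in> Gr"
proof -
  have "inj ((*v) (frame g X))"
    using frame_inject [OF assms] by (auto simp: inj_on_def)
  then have "dim (range ((*v) (frame g X))) = dim (UNIV :: (real^2) set)"
    by (intro dim_image_eq) auto
  then show ?thesis
    unfolding Gr_def by (simp add: chart_eq_range [symmetric]) (simp add: chart_def)
qed

lemma chart_trans_map:
  assumes "h \<in> SL4" "det (J g h X) \<noteq> 0"
  shows "chart h (trans_map g h X) = chart g X"
proof -
  let ?F = "frame h (trans_map g h X)"
  have eq: "frame g X *v v = ?F *v (J g h X *v v)" for v
    using frame_trans_map [OF assms] by (simp add: matrix_vector_mul_assoc)
  have "?F *v v = frame g X *v (matrix_inv (J g h X) *v v)" for v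
    unfolding eq using invertible_matrix_inv(1) [of "J g h X"] assms(2)
    by (simp add: matrix_vector_mul_assoc matrix_mul_assoc [symmetric] invertible_det_nz)
  then show ?thesis
    unfolding chart_eq_range
  proof (intro equalityI image_subsetI)
    show "frame g X *v v \<in> range ((*v) ?F)" for v
      unfolding eq by (rule rangeI)
    show "?F *v v \<in> range ((*v) (frame g X))" for v
      by (subst \<open>\<And>v. ?F *v v = _\<close>) (rule rangeI)
  qed
qed

lemma smooth_frame: "smooth (frame g)"
proof -
  have "bounded_linear (\<lambda>X. stack X 0)"
    unfolding linear_conv_bounded_linear [symmetric]
    by (rule linearI) (simp_all add: stack_def vec_eq_iff forall_4 forall_2)
  then have "smooth (\<lambda>X. g ** (stack X 0 + stack 0 (mat 1)))"
    by (intro smooth_matrix_mult smooth_add smooth_const smooth_linear)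
  moreover have "frame g X = g ** (stack X 0 + stack 0 (mat 1))" for X
    by (simp add: frame_def, rule arg_cong [where f = "(**) g"])
      (simp add: stack_def vec_eq_iff forall_4 forall_2)
  ultimately show ?thesis by presburger
qed

lemma smooth_J: "smooth (J g h)"
proof -
  have "smooth (\<lambda>X. blk21 (matrix_inv h ** g) ** X + blk22 (matrix_inv h ** g))"
    by (intro smooth_add smooth_matrix_mult smooth_const smooth_ident)
  then show ?thesis by (simp add: J_def [abs_def] Let_def)
qed

lemma J_has_derivative:
  "(J g h has_derivative (\<lambda>Y. blk21 (matrix_inv h ** g) ** Y)) (at X)"
  unfolding J_def [abs_def] Let_def
  by (auto intro!: derivative_eq_intros bounded_linear_imp_has_derivative
      bounded_bilinear.bounded_linear_right [OF bounded_bilinear_matrix_matrix_mult])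

lemma open_det_J: "open {X. det (J g h X) \<noteq> 0}"
proof -
  have "continuous_on UNIV (\<lambda>X. det (J g h X))"
    using smooth_continuous [OF smooth_det2 [OF smooth_J]] by (simp add: continuous_at_imp_continuous_on)
  then have "open ((\<lambda>X. det (J g h X)) -` (- {0}))"
    by (intro open_vimage) auto
  then show ?thesis by (simp add: vimage_def)
qed

text \<open>\<open>matrix_inv\<close> is an unspecified choice at singular matrices, so it is
  compared with the adjugate formula, which agrees with it on the open set where det J is
  nonzero.\<close>

lemma trans_map_differentiable:
  assumes "det (J g h X) \<noteq> 0"
  shows "trans_map g h differentiable (at X)"
proof -
  let ?k = "matrix_inv h ** g"
  let ?T = "\<lambda>X. (blk11 ?k ** X + blk12 ?k) ** (inverse (det (J g h X)) *\<^sub>R adj2 (J g h X))"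
  let ?S = "{X. det (J g h X) \<noteq> 0}"
  have "((\<lambda>X. inverse (det (J g h X))) has_derivative
      (\<lambda>v. - (inverse (det (J g h X)) * frechet_derivative (\<lambda>X. det (J g h X)) (at X) v * inverse (det (J g h X))))) (at X)"
    by (intro Deriv.has_derivative_inverse assms smooth_has_derivative smooth_det2 smooth_J)
  from bounded_bilinear.FDERIV [OF bounded_bilinear_scaleR this
      smooth_has_derivative [OF smooth_bounded_linear [OF bounded_linear_adj2 smooth_J]]]
  obtain D where "((\<lambda>X. inverse (det (J g h X)) *\<^sub>R adj2 (J g h X)) has_derivative D) (at X)" by blast
  moreover have "smooth (\<lambda>X. blk11 ?k ** X + blk12 ?k)"
    by (intro smooth_add smooth_matrix_mult smooth_const smooth_ident)
  ultimately obtain D' where "(?T has_derivative D') (at X)"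
    using bounded_bilinear.FDERIV [OF bounded_bilinear_matrix_matrix_mult smooth_has_derivative] by blast
  moreover have "?T Z = trans_map g h Z" if "det (J g h Z) \<noteq> 0" for Z
    using that by (simp add: trans_map_def Let_def matrix_inv_eq_adj2)
  ultimately have "(trans_map g h has_derivative D') (at X)"
    using assms by (elim has_derivative_transform_within_open [OF _ open_det_J]) auto
  then show ?thesis by (rule differentiableI)
qed

lemma trans_map_derivative:
  assumes "det (J g h X) \<noteq> 0"
  shows "frechet_derivative (trans_map g h) (at X) Y ** J g h X =
    (blk11 (matrix_inv h ** g) - trans_map g h X ** blk21 (matrix_inv h ** g)) ** Y"
proof -
  let ?k = "matrix_inv h ** g" and ?D = "frechet_derivative (trans_map g h) (at X)"
  have "((\<lambda>X. trans_map g h X ** J g h X) has_derivative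
      (\<lambda>Y. trans_map g h X ** (blk21 ?k ** Y) + ?D Y ** J g h X)) (at X)"
    by (intro bounded_bilinear.FDERIV [OF bounded_bilinear_matrix_matrix_mult]
        has_frechet_derivative trans_map_differentiable assms J_has_derivative)
  then have "((\<lambda>X. blk11 ?k ** X + blk12 ?k) has_derivative
      (\<lambda>Y. trans_map g h X ** (blk21 ?k ** Y) + ?D Y ** J g h X)) (at X)"
    by (rule has_derivative_transform_within_open [OF _ open_det_J])
      (use assms in \<open>auto simp: trans_map_mult_J\<close>)
  moreover have "((\<lambda>X. blk11 ?k ** X + blk12 ?k) has_derivative (\<lambda>Y. blk11 ?k ** Y)) (at X)"
    by (auto intro!: derivative_eq_intros bounded_linear_imp_has_derivative
      bounded_bilinear.bounded_linear_right [OF bounded_bilinear_matrix_matrix_mult])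
  ultimately have "(\<lambda>Y. trans_map g h X ** (blk21 ?k ** Y) + ?D Y ** J g h X) = (\<lambda>Y. blk11 ?k ** Y)"
    by (rule has_derivative_unique)
  then have "trans_map g h X ** (blk21 ?k ** Y) + ?D Y ** J g h X = blk11 ?k ** Y"
    by meson
  then show ?thesis
    by (simp add: matrix_matrix_mult_diff matrix_mul_assoc algebra_simps)
qed

section \<open>Gauge transformation of the ansatz\<close>

lemma trace_mult_eq_imp_eq:
  fixes A B :: mat2
  assumes "\<And>Y. trace (A ** Y) = trace (B ** Y)"
  shows "A = B"
proof -
  have "A $ i $ j = B $ i $ j" for i j
    using assms [of "\<chi> k l. if k = j \<and> l = i then 1 else 0"] exhaust_2 [of i] exhaust_2 [of j]
    by (auto simp: trace_def matrix_matrix_mult_def sum_2)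
  then show ?thesis by (simp add: vec_eq_iff)
qed

text \<open>This pairing is the reason for the transposed indices in \<open>dX_grad\<close>: the
  trace matches its (i,j) entry with the (j,i) entry of \<open>Y\<close>.\<close>

lemma frechet_derivative_eq_trace:
  assumes "f differentiable (at X)"
  shows "frechet_derivative f (at X) Y = trace (dX_grad f X ** Y)"
proof -
  let ?D = "frechet_derivative f (at X)"
  have lin: "linear ?D" using assms by (rule linear_frechet_derivative)
  have "Y = Y$1$1 *\<^sub>R axis 1 (axis 1 1) + Y$1$2 *\<^sub>R axis 1 (axis 2 1)
      + Y$2$1 *\<^sub>R axis 2 (axis 1 1) + Y$2$2 *\<^sub>R axis 2 (axis 2 1)"
    by (simp add: vec_eq_iff forall_2 axis_def)
  then have "?D Y = ?D (Y$1$1 *\<^sub>R axis 1 (axis 1 1) + Y$1$2 *\<^sub>R axis 1 (axis 2 1)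
      + Y$2$1 *\<^sub>R axis 2 (axis 1 1) + Y$2$2 *\<^sub>R axis 2 (axis 2 1))" by simp
  also have "\<dots> = trace (dX_grad f X ** Y)"
    by (simp add: linear_add [OF lin] linear_scale [OF lin] trace_def matrix_matrix_mult_def sum_2
        dX_grad_def partial_def algebra_simps)
  finally show ?thesis .
qed

text \<open>Jacobi's formula for the derivative of a determinant.\<close>

lemma det2_has_derivative:
  fixes M :: "'a::real_normed_vector \<Rightarrow> mat2"
  assumes "(M has_derivative M') (at x)"
  shows "((\<lambda>x. det (M x)) has_derivative (\<lambda>v. trace (adj2 (M x) ** M' v))) (at x)"
proof -
  have c: "((\<lambda>x. M x $ i $ j) has_derivative (\<lambda>v. M' v $ i $ j)) (at x)" for i j
    using assms by (intro bounded_linear.has_derivative [OF bounded_linear_vec_nth])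
  have "((\<lambda>x. M x $ 1 $ 1 * M x $ 2 $ 2 - M x $ 1 $ 2 * M x $ 2 $ 1) has_derivative
      (\<lambda>v. (M x $ 1 $ 1 * M' v $ 2 $ 2 + M' v $ 1 $ 1 * M x $ 2 $ 2)
         - (M x $ 1 $ 2 * M' v $ 2 $ 1 + M' v $ 1 $ 2 * M x $ 2 $ 1))) (at x)"
    by (intro has_derivative_diff has_derivative_mult c)
  moreover have "(M x $ 1 $ 1 * M' v $ 2 $ 2 + M' v $ 1 $ 1 * M x $ 2 $ 2)
      - (M x $ 1 $ 2 * M' v $ 2 $ 1 + M' v $ 1 $ 2 * M x $ 2 $ 1) = trace (adj2 (M x) ** M' v)" for v
    by (simp add: adj2_def trace_def matrix_matrix_mult_def sum_2)
  ultimately show ?thesis by (simp add: det_2)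
qed

lemma trace_scaleR: "trace (c *\<^sub>R A) = c * trace (A :: real^'n^'n)"
  by (simp add: trace_def sum_distrib_left)

text \<open>Differentiating the logarithm of \<open>f\<^sub>h \<circ> \<Psi> = \<bar>det J\<bar> f\<^sub>g\<close>; the sign of \<open>det J\<close> is locally constant.\<close>

lemma log_derivative_trans_map:
  assumes fh: "smooth fh" and fg: "smooth fg" and nz: "fg X \<noteq> 0"
    and det: "det (J g h X) \<noteq> 0"
    and trans: "\<And>Z. det (J g h Z) \<noteq> 0 \<Longrightarrow> fh (trans_map g h Z) = \<bar>det (J g h Z)\<bar> * fg Z"
  shows "frechet_derivative fh (at (trans_map g h X)) (frechet_derivative (trans_map g h) (at X) Y)
      / fh (trans_map g h X) =
    frechet_derivative fg (at X) Y / fg X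
      + trace (matrix_inv (J g h X) ** (blk21 (matrix_inv h ** g) ** Y))"
proof -
  let ?T = "trans_map g h" and ?k = "blk21 (matrix_inv h ** g)" and ?d = "det (J g h X)"
  let ?S = "{Z. 0 < sgn ?d * det (J g h Z)}"
  have "continuous_on UNIV (\<lambda>Z. sgn ?d * det (J g h Z))"
    using smooth_continuous [OF smooth_det2 [OF smooth_J]]
    by (intro continuous_intros) (simp add: continuous_at_imp_continuous_on)
  then have "open ((\<lambda>Z. sgn ?d * det (J g h Z)) -` {0<..})"
    by (intro open_vimage) auto
  then have op: "open ?S" by (simp add: vimage_def)
  have mem: "X \<in> ?S" using det by (simp add: sgn_if)
  have eq: "fh (?T Z) = sgn ?d * det (J g h Z) * fg Z" if "Z \<in> ?S" for Z
    using that det trans [of Z] by (cases "?d > 0") auto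
  have "((\<lambda>Z. fh (?T Z)) has_derivative
      (\<lambda>Y. frechet_derivative fh (at (?T X)) (frechet_derivative ?T (at X) Y))) (at X)"
    by (rule has_derivative_compose [OF has_frechet_derivative [OF trans_map_differentiable [OF det]]
          smooth_has_derivative [OF fh]])
  then have "((\<lambda>Z. sgn ?d * det (J g h Z) * fg Z) has_derivative
      (\<lambda>Y. frechet_derivative fh (at (?T X)) (frechet_derivative ?T (at X) Y))) (at X)"
    by (rule has_derivative_transform_within_open [OF _ op mem]) (rule eq)
  moreover have "((\<lambda>Z. sgn ?d * det (J g h Z) * fg Z) has_derivative
      (\<lambda>Y. sgn ?d * ?d * frechet_derivative fg (at X) Y
        + sgn ?d * trace (adj2 (J g h X) ** (?k ** Y)) * fg X)) (at X)"
    by (intro has_derivative_mult has_derivative_mult_right det2_has_derivative J_has_derivative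
        smooth_has_derivative fg)
  ultimately have "(\<lambda>Y. frechet_derivative fh (at (?T X)) (frechet_derivative ?T (at X) Y)) =
      (\<lambda>Y. sgn ?d * ?d * frechet_derivative fg (at X) Y
        + sgn ?d * trace (adj2 (J g h X) ** (?k ** Y)) * fg X)"
    by (rule has_derivative_unique)
  then have "frechet_derivative fh (at (?T X)) (frechet_derivative ?T (at X) Y) =
      sgn ?d * ?d * frechet_derivative fg (at X) Y + sgn ?d * trace (adj2 (J g h X) ** (?k ** Y)) * fg X"
    by (rule fun_cong)
  moreover have "trace (matrix_inv (J g h X) ** (?k ** Y)) = trace (adj2 (J g h X) ** (?k ** Y)) / ?d"
    using det by (simp add: matrix_inv_eq_adj2 scalar_matrix_assoc [symmetric] trace_scaleR divide_inverse_commute)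
  moreover have "sgn ?d \<noteq> 0" using det by (simp add: sgn_if)
  ultimately show ?thesis
    using det nz eq [OF mem] by (simp add: field_simps)
qed

text \<open>The gauge law: by \<open>J_has_derivative\<close> the subtracted term is the derivative
  of J along \<open>Y\<close>. It is stated with J multiplied across rather than inverted, the form
  in which it meets section coordinates later.\<close>

lemma tHooft_trans_map:
  assumes fh: "smooth fh" and fg: "smooth fg" and nz: "fg X \<noteq> 0"
    and det: "det (J g h X) \<noteq> 0"
    and trans: "\<And>Z. det (J g h Z) \<noteq> 0 \<Longrightarrow> fh (trans_map g h Z) = \<bar>det (J g h Z)\<bar> * fg Z"
  shows "tHooft fh (trans_map g h X) (frechet_derivative (trans_map g h) (at X) Y) ** J g h X =
    J g h X ** tHooft fg X Y - blk21 (matrix_inv h ** g) ** Y"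
proof -
  let ?T = "trans_map g h X" and ?k = "blk21 (matrix_inv h ** g)" and ?J = "J g h X"
  let ?D = "frechet_derivative (trans_map g h) (at X)"
  let ?K = "blk11 (matrix_inv h ** g) - ?T ** ?k" and ?I = "matrix_inv ?J"
  define Gh where "Gh = (1 / fh ?T) *\<^sub>R dX_grad fh ?T"
  define Gg where "Gg = (1 / fg X) *\<^sub>R dX_grad fg X"
  have I: "?J ** ?I = mat 1" "?I ** ?J = mat 1"
    using det by (simp_all add: invertible_matrix_inv invertible_det_nz)
  have DJ: "?D Y ** ?J = ?K ** Y" for Y
    using det by (rule trans_map_derivative)
  have D: "?D Y = ?K ** Y ** ?I" for Y
    using arg_cong [OF DJ, of "\<lambda>M. M ** ?I"] by (simp add: matrix_mul_assoc [symmetric] I)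
  \<comment> \<open>By \<open>D\<close>, the transported vector ends in \<open>?I\<close>. Cyclicity
    of the trace moves this factor to the front, leaving \<open>Y\<close> last on both sides, so a
    scalar identity for all \<open>Y\<close> becomes an identity of matrices.\<close>
  have "?I ** Gh ** ?K = Gg + ?I ** ?k"
  proof (rule trace_mult_eq_imp_eq)
    fix Y
    have "trace (Gh ** ?D Y) = trace (Gg ** Y) + trace (?I ** (?k ** Y))"
      using log_derivative_trans_map [OF assms, of Y]
      by (simp add: frechet_derivative_eq_trace smooth_differentiable fh fg Gh_def Gg_def
          scalar_matrix_assoc [symmetric] trace_scaleR)
    moreover have "trace (Gh ** ?D Y) = trace (?I ** Gh ** ?K ** Y)"
      using trace_mul_sym [of "Gh ** ?K ** Y" ?I] by (simp add: D matrix_mul_assoc)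
    ultimately show "trace (?I ** Gh ** ?K ** Y) = trace ((Gg + ?I ** ?k) ** Y)"
      by (simp add: matrix_matrix_mult_add_left trace_add matrix_mul_assoc)
  qed
  from arg_cong [OF this, of "\<lambda>M. ?J ** M"]
  have GK: "Gh ** ?K = ?J ** Gg + ?k"
    by (simp add: matrix_add_ldistrib matrix_mul_assoc I)
  have tH: "tHooft fh ?T Z = - (Gh ** Z)" "tHooft fg X Z = - (Gg ** Z)" for Z
    by (simp_all add: tHooft_def Gh_def Gg_def scalar_matrix_assoc [symmetric])
  have "tHooft fh ?T (?D Y) ** ?J = - (Gh ** (?D Y ** ?J))"
    by (simp add: tH matrix_matrix_mult_uminus matrix_mul_assoc)
  also have "\<dots> = - ((Gh ** ?K) ** Y)"
    by (simp add: DJ matrix_mul_assoc)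
  also have "\<dots> = ?J ** tHooft fg X Y - ?k ** Y"
    by (simp add: GK tH matrix_matrix_mult_uminus matrix_matrix_mult_add_left matrix_mul_assoc)
  finally show ?thesis .
qed

lemma smooth_dX_grad:
  assumes "smooth f"
  shows "smooth (dX_grad f)"
proof -
  have "smooth (\<lambda>X. partial i j f X)" for i j
    unfolding partial_def by (rule smooth_frechet_derivative [OF assms])
  then have "smooth (\<lambda>X. partial 1 1 f X *\<^sub>R axis 1 (axis 1 1) + partial 2 1 f X *\<^sub>R axis 1 (axis 2 1)
    + partial 1 2 f X *\<^sub>R axis 2 (axis 1 1) + partial 2 2 f X *\<^sub>R (axis 2 (axis 2 1) :: mat2))"
    by (intro smooth_add smooth_scaleR smooth_const)
  moreover have "dX_grad f X = partial 1 1 f X *\<^sub>R axis 1 (axis 1 1) + partial 2 1 f X *\<^sub>R axis 1 (axis 2 1)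
    + partial 1 2 f X *\<^sub>R axis 2 (axis 1 1) + partial 2 2 f X *\<^sub>R (axis 2 (axis 2 1) :: mat2)" for X
    by (simp add: dX_grad_def vec_eq_iff forall_2 axis_def)
  ultimately show ?thesis by presburger
qed

lemma matrix_one_form_tHooft:
  assumes "smooth f" "\<And>X. f X \<noteq> 0"
  shows "matrix_one_form (tHooft f)"
  unfolding matrix_one_form_def
proof (intro conjI allI)
  show "linear (tHooft f X)" for X
    by (rule linearI)
      (simp_all add: tHooft_def matrix_add_ldistrib scaleR_add_right matrix_scalar_ac scalar_matrix_assoc [symmetric])
  have "smooth (\<lambda>X. - inverse (f X))"
    by (rule smooth_bounded_linear [OF bounded_linear_minus [OF bounded_linear_ident] smooth_inverse])
      (use assms in auto)
  then have "smooth (\<lambda>X. (- inverse (f X)) *\<^sub>R (dX_grad f X ** Y))" for Y :: mat2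
    by (intro smooth_scaleR smooth_matrix_mult smooth_const smooth_dX_grad assms)
  then show "smooth (\<lambda>X. tHooft f X Y)" for Y
    by (simp add: tHooft_def divide_inverse)
qed

section \<open>Connections and their potentials\<close>

text \<open>For \<open>g\<close> in \<open>SL4\<close> the frame is injective, so these coordinates
  are the smooth ones whose existence \<open>sections_P\<close> asserts. Derivatives of sections are
  taken on them, in a fixed vector space.\<close>

definition frame_coords :: "mat4 \<Rightarrow> ((real^4) set \<Rightarrow> real^4) \<Rightarrow> mat2 \<Rightarrow> real^2" where
  "frame_coords g \<sigma> X = (THE v. \<sigma> (chart g X) = frame g X *v v)"

lemma frame_coords_eq:
  assumes "g \<in> SL4" "\<sigma> (chart g X) = frame g X *v v"
  shows "frame_coords g \<sigma> X = v"
  unfolding frame_coords_def using assms by (auto simp: frame_inject)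

lemma
  assumes "g \<in> SL4" "\<sigma> \<in> sections_P"
  shows smooth_frame_coords: "smooth (frame_coords g \<sigma>)"
    and frame_mult_frame_coords: "frame g X *v frame_coords g \<sigma> X = \<sigma> (chart g X)"
proof -
  obtain v where v: "smooth v" "\<And>X. \<sigma> (chart g X) = frame g X *v v X"
    using assms unfolding sections_P_def smooth_in_frame_def by blast
  have "frame_coords g \<sigma> = v"
    using frame_coords_eq [OF assms(1)] v(2) by blast
  then show "smooth (frame_coords g \<sigma>)" "frame g X *v frame_coords g \<sigma> X = \<sigma> (chart g X)"
    using v by simp_all
qed

lemma frame_coords_trans_map:
  assumes "g \<in> SL4" "h \<in> SL4" "\<sigma> \<in> sections_P" "det (J g h X) \<noteq> 0"
  shows "frame_coords h \<sigma> (trans_map g h X) = J g h X *v frame_coords g \<sigma> X"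
proof (rule frame_coords_eq [OF assms(2)])
  have "\<sigma> (chart h (trans_map g h X)) = frame g X *v frame_coords g \<sigma> X"
    using assms by (simp add: chart_trans_map frame_mult_frame_coords)
  then show "\<sigma> (chart h (trans_map g h X)) =
      frame h (trans_map g h X) *v (J g h X *v frame_coords g \<sigma> X)"
    using assms by (simp add: matrix_vector_mul_assoc frame_trans_map)
qed

text \<open>Differentiating v_h o T = J v_g by the product rule. The second summand is dJ applied to
  v_g, the non-tensorial term that the gauge law of the potential must compensate.\<close>

lemma frame_coords_derivative_trans_map:
  assumes "g \<in> SL4" "h \<in> SL4" "\<sigma> \<in> sections_P" "det (J g h X) \<noteq> 0"
  shows "frechet_derivative (frame_coords h \<sigma>) (at (trans_map g h X))
      (frechet_derivative (trans_map g h) (at X) Y) =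
    J g h X *v frechet_derivative (frame_coords g \<sigma>) (at X) Y
      + (blk21 (matrix_inv h ** g) ** Y) *v frame_coords g \<sigma> X"
proof -
  have "((\<lambda>Z. frame_coords h \<sigma> (trans_map g h Z)) has_derivative
      (\<lambda>Y. frechet_derivative (frame_coords h \<sigma>) (at (trans_map g h X))
        (frechet_derivative (trans_map g h) (at X) Y))) (at X)"
    by (rule has_derivative_compose [OF has_frechet_derivative [OF trans_map_differentiable [OF assms(4)]]
          smooth_has_derivative [OF smooth_frame_coords [OF assms(2,3)]]])
  then have "((\<lambda>Z. J g h Z *v frame_coords g \<sigma> Z) has_derivative
      (\<lambda>Y. frechet_derivative (frame_coords h \<sigma>) (at (trans_map g h X))
        (frechet_derivative (trans_map g h) (at X) Y))) (at X)"
    by (rule has_derivative_transform_within_open [OF _ open_det_J])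
      (use assms in \<open>auto simp: frame_coords_trans_map\<close>)
  moreover have "((\<lambda>Z. J g h Z *v frame_coords g \<sigma> Z) has_derivative
      (\<lambda>Y. J g h X *v frechet_derivative (frame_coords g \<sigma>) (at X) Y
        + (blk21 (matrix_inv h ** g) ** Y) *v frame_coords g \<sigma> X)) (at X)"
    by (rule bounded_bilinear.FDERIV [OF bounded_bilinear_matrix_vector_mult J_has_derivative
          smooth_has_derivative [OF smooth_frame_coords [OF assms(1,3)]]])
  ultimately show ?thesis
    by (rule has_derivative_unique [THEN fun_cong])
qed

lemma sections_P_I:
  assumes "\<sigma> \<in> extensional Gr" "\<And>p. p \<in> Gr \<Longrightarrow> \<sigma> p \<in> p"
    "\<And>g. g \<in> SL4 \<Longrightarrow> smooth (v g)" "\<And>g X. g \<in> SL4 \<Longrightarrow> \<sigma> (chart g X) = frame g X *v v g X"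
  shows "\<sigma> \<in> sections_P"
  using assms unfolding sections_P_def smooth_in_frame_def PiE_def Pi_def by blast

lemma sections_P_mem: "\<sigma> \<in> sections_P \<Longrightarrow> p \<in> Gr \<Longrightarrow> \<sigma> p \<in> p"
  unfolding sections_P_def by auto

lemma Gr_subspace: "p \<in> Gr \<Longrightarrow> subspace p"
  by (simp add: Gr_def)

lemma
  assumes "\<sigma> \<in> sections_P" "\<tau> \<in> sections_P"
  shows sections_P_add: "(\<lambda>p\<in>Gr. \<sigma> p + \<tau> p) \<in> sections_P" (is "?\<rho> \<in> _")
    and frame_coords_add: "g \<in> SL4 \<Longrightarrow>
      frame_coords g (\<lambda>p\<in>Gr. \<sigma> p + \<tau> p) = (\<lambda>X. frame_coords g \<sigma> X + frame_coords g \<tau> X)"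
proof -
  have eq: "?\<rho> (chart g X) = frame g X *v (frame_coords g \<sigma> X + frame_coords g \<tau> X)" if "g \<in> SL4" for g X
    using that assms by (simp add: chart_in_Gr matrix_vector_right_distrib frame_mult_frame_coords)
  show "?\<rho> \<in> sections_P"
    by (rule sections_P_I [where v = "\<lambda>g X. frame_coords g \<sigma> X + frame_coords g \<tau> X"])
      (use assms eq in \<open>auto intro: subspace_add Gr_subspace sections_P_mem smooth_add smooth_frame_coords\<close>)
  show "frame_coords g ?\<rho> = (\<lambda>X. frame_coords g \<sigma> X + frame_coords g \<tau> X)" if "g \<in> SL4"
    by (rule ext, rule frame_coords_eq [OF that]) (rule eq [OF that])
qed

lemma
  assumes "u \<in> smooth_functions" "\<sigma> \<in> sections_P"
  shows sections_P_scaleR: "(\<lambda>p\<in>Gr. u p *\<^sub>R \<sigma> p) \<in> sections_P" (is "?\<rho> \<in> _")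
    and frame_coords_scaleR: "g \<in> SL4 \<Longrightarrow>
      frame_coords g (\<lambda>p\<in>Gr. u p *\<^sub>R \<sigma> p) = (\<lambda>X. u (chart g X) *\<^sub>R frame_coords g \<sigma> X)"
proof -
  have eq: "?\<rho> (chart g X) = frame g X *v (u (chart g X) *\<^sub>R frame_coords g \<sigma> X)" if "g \<in> SL4" for g X
    using that assms by (simp add: chart_in_Gr matrix_vector_mult_scaleR frame_mult_frame_coords)
  have "smooth (\<lambda>X. u (chart g X))" if "g \<in> SL4" for g
    using assms(1) that by (simp add: smooth_functions_def)
  then show "?\<rho> \<in> sections_P"
    by (intro sections_P_I [where v = "\<lambda>g X. u (chart g X) *\<^sub>R frame_coords g \<sigma> X"])
      (use assms eq in \<open>auto intro: subspace_scale Gr_subspace sections_P_mem smooth_scaleR smooth_frame_coords\<close>)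
  show "frame_coords g ?\<rho> = (\<lambda>X. u (chart g X) *\<^sub>R frame_coords g \<sigma> X)" if "g \<in> SL4"
    by (rule ext, rule frame_coords_eq [OF that]) (rule eq [OF that])
qed

text \<open>The local formula d + A is used in every chart at once. Restriction in both arguments
  matches the extensionality demanded by \<open>connections_P\<close> and
  \<open>one_forms_P\<close>.\<close>

definition tHooft_connection :: "(mat4 \<Rightarrow> mat2 \<Rightarrow> real) \<Rightarrow> connection" where
  "tHooft_connection s = (\<lambda>\<sigma>\<in>sections_P. \<lambda>g\<in>SL4. \<lambda>X Y. frame g X *v
     (frechet_derivative (frame_coords g \<sigma>) (at X) Y + tHooft (s g) X Y *v frame_coords g \<sigma> X))"

lemma nonvanishing_sections_D:
  assumes "s \<in> nonvanishing_sections" "g \<in> SL4"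
  shows "smooth (s g)" "s g X \<noteq> 0"
    "h \<in> SL4 \<Longrightarrow> det (J g h X) \<noteq> 0 \<Longrightarrow> s h (trans_map g h X) = \<bar>det (J g h X)\<bar> * s g X"
  using assms unfolding nonvanishing_sections_def twisted_sections_minus_one by auto

lemma tHooft_connection_one_form:
  assumes s: "s \<in> nonvanishing_sections" and \<sigma>: "\<sigma> \<in> sections_P"
  shows "tHooft_connection s \<sigma> \<in> one_forms_P"
  unfolding one_forms_P_def
proof (intro CollectI conjI ballI allI impI)
  show "tHooft_connection s \<sigma> \<in> extensional SL4"
    using \<sigma> by (simp add: tHooft_connection_def)
next
  fix g X assume g: "g \<in> SL4"
  have "linear (\<lambda>Y. frechet_derivative (frame_coords g \<sigma>) (at X) Y)"
    by (rule linear_frechet_derivative_smooth [OF smooth_frame_coords [OF g \<sigma>]])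
  moreover have "linear (tHooft (s g) X)"
    using matrix_one_form_tHooft nonvanishing_sections_D [OF s g] unfolding matrix_one_form_def by blast
  ultimately show "linear (tHooft_connection s \<sigma> g X)"
    using \<sigma> g by (intro linearI)
      (simp_all add: tHooft_connection_def linear_add linear_scale matrix_vector_right_distrib
        matrix_vector_mult_add_rdistrib scaleR_matrix_vector_assoc [symmetric] matrix_vector_mult_scaleR algebra_simps)
next
  fix g Y assume g: "g \<in> SL4"
  have "smooth (\<lambda>X. frechet_derivative (frame_coords g \<sigma>) (at X) Y + tHooft (s g) X Y *v frame_coords g \<sigma> X)"
    using matrix_one_form_tHooft [OF nonvanishing_sections_D(1,2) [OF s g]]
    unfolding matrix_one_form_def
    by (intro smooth_add smooth_frechet_derivative smooth_matrix_vector_mult smooth_frame_coords g \<sigma>) auto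
  then show "smooth_in_frame g (\<lambda>X. tHooft_connection s \<sigma> g X Y)"
    using g \<sigma> unfolding smooth_in_frame_def tHooft_connection_def by auto
next
  fix g h X Y assume g: "g \<in> SL4" and h: "h \<in> SL4" and det: "det (J g h X) \<noteq> 0"
  let ?T = "trans_map g h X" and ?D = "frechet_derivative (trans_map g h) (at X) Y"
  let ?v = "frame_coords g \<sigma> X" and ?k = "blk21 (matrix_inv h ** g) ** Y"
  have "tHooft_connection s \<sigma> h ?T ?D = frame h ?T *v
      (frechet_derivative (frame_coords h \<sigma>) (at ?T) ?D + tHooft (s h) ?T ?D *v frame_coords h \<sigma> ?T)"
    using h \<sigma> by (simp add: tHooft_connection_def)
  also have "\<dots> = frame h ?T *v
      (J g h X *v frechet_derivative (frame_coords g \<sigma>) (at X) Y + ?k *v ?v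
        + (tHooft (s h) ?T ?D ** J g h X) *v ?v)"
    by (simp add: frame_coords_derivative_trans_map frame_coords_trans_map g h \<sigma> det matrix_vector_mul_assoc)
  \<comment> \<open>The \<open>?k\<close> subtracted here cancels the one produced by
    differentiating the coordinates. What remains has J as a common left factor, which turns the
    \<open>h\<close>-frame into the \<open>g\<close>-frame.\<close>
  also have "tHooft (s h) ?T ?D ** J g h X = J g h X ** tHooft (s g) X Y - ?k"
    by (rule tHooft_trans_map) (use nonvanishing_sections_D [OF s] g h det in auto)
  also have "frame h ?T *v (J g h X *v frechet_derivative (frame_coords g \<sigma>) (at X) Y + ?k *v ?v
        + (J g h X ** tHooft (s g) X Y - ?k) *v ?v) =
      (frame h ?T ** J g h X) *v (frechet_derivative (frame_coords g \<sigma>) (at X) Y + tHooft (s g) X Y *v ?v)"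
    by (simp add: matrix_vector_mult_diff_rdistrib matrix_vector_right_distrib matrix_vector_mul_assoc matrix_mul_assoc)
  also have "\<dots> = tHooft_connection s \<sigma> g X Y"
    using g h \<sigma> det by (simp add: tHooft_connection_def frame_trans_map)
  finally show "tHooft_connection s \<sigma> h ?T ?D = tHooft_connection s \<sigma> g X Y" .
qed

lemma tHooft_connection_in_connections_P:
  assumes s: "s \<in> nonvanishing_sections"
  shows "tHooft_connection s \<in> connections_P"
  unfolding connections_P_def
proof (intro CollectI conjI ballI allI)
  show "tHooft_connection s \<in> sections_P \<rightarrow>\<^sub>E one_forms_P"
    using tHooft_connection_one_form [OF s] by (auto simp: PiE_def) (simp add: tHooft_connection_def)
next
  fix \<sigma> \<tau> g X Y
  assume \<sigma>: "\<sigma> \<in> sections_P" and \<tau>: "\<tau> \<in> sections_P" and g: "g \<in> SL4"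
  have "((\<lambda>X. frame_coords g \<sigma> X + frame_coords g \<tau> X) has_derivative
      (\<lambda>Y. frechet_derivative (frame_coords g \<sigma>) (at X) Y + frechet_derivative (frame_coords g \<tau>) (at X) Y)) (at X)"
    by (intro has_derivative_add smooth_has_derivative smooth_frame_coords g \<sigma> \<tau>)
  note d = frechet_derivative_eq [OF this]
  show "tHooft_connection s (\<lambda>p\<in>Gr. \<sigma> p + \<tau> p) g X Y =
      tHooft_connection s \<sigma> g X Y + tHooft_connection s \<tau> g X Y"
    using g \<sigma> \<tau>
    by (simp add: tHooft_connection_def sections_P_add frame_coords_add d matrix_vector_right_distrib algebra_simps)
next
  fix u \<sigma> g X Y
  assume u: "u \<in> smooth_functions" and \<sigma>: "\<sigma> \<in> sections_P" and g: "g \<in> SL4"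
  have "smooth (\<lambda>X. u (chart g X))"
    using u g by (simp add: smooth_functions_def)
  then have "((\<lambda>X. u (chart g X) *\<^sub>R frame_coords g \<sigma> X) has_derivative
      (\<lambda>Y. u (chart g X) *\<^sub>R frechet_derivative (frame_coords g \<sigma>) (at X) Y +
        frechet_derivative (\<lambda>X. u (chart g X)) (at X) Y *\<^sub>R frame_coords g \<sigma> X)) (at X)"
    by (intro has_derivative_scaleR smooth_has_derivative smooth_frame_coords g \<sigma>)
  note d = frechet_derivative_eq [OF this]
  have "tHooft_connection s (\<lambda>p\<in>Gr. u p *\<^sub>R \<sigma> p) g X Y =
      frechet_derivative (\<lambda>Z. u (chart g Z)) (at X) Y *\<^sub>R (frame g X *v frame_coords g \<sigma> X)
        + u (chart g X) *\<^sub>R tHooft_connection s \<sigma> g X Y"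
    using g \<sigma> u
    by (simp add: tHooft_connection_def sections_P_scaleR frame_coords_scaleR d
        matrix_vector_right_distrib matrix_vector_mult_scaleR algebra_simps)
  then show "tHooft_connection s (\<lambda>p\<in>Gr. u p *\<^sub>R \<sigma> p) g X Y =
      frechet_derivative (\<lambda>Z. u (chart g Z)) (at X) Y *\<^sub>R \<sigma> (chart g X)
        + u (chart g X) *\<^sub>R tHooft_connection s \<sigma> g X Y"
    using g \<sigma> by (simp add: frame_mult_frame_coords)
qed

lemma has_potential_tHooft_connection:
  assumes s: "s \<in> nonvanishing_sections" and g: "g \<in> SL4"
  shows "has_potential (tHooft_connection s) g (tHooft (s g))"
  unfolding has_potential_def
proof (intro conjI ballI allI impI)
  show "matrix_one_form (tHooft (s g))"
    using nonvanishing_sections_D [OF s g] by (intro matrix_one_form_tHooft)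
next
  fix \<sigma> v X Y
  assume \<sigma>: "\<sigma> \<in> sections_P" and "\<forall>X. \<sigma> (chart g X) = frame g X *v v X"
  then have "frame_coords g \<sigma> = v"
    using frame_coords_eq [OF g] by blast
  then show "tHooft_connection s \<sigma> g X Y =
      frame g X *v (frechet_derivative v (at X) Y + tHooft (s g) X Y *v v X)"
    using \<sigma> g by (simp add: tHooft_connection_def)
qed

text \<open>Every global section has coordinates in every standard frame, so the potentials fix all
  meaningful values; the remaining values are fixed by extensionality.\<close>

lemma connections_P_eqI:
  assumes D: "D \<in> connections_P" and D': "D' \<in> connections_P"
    and pot: "\<And>g. g \<in> SL4 \<Longrightarrow> has_potential D g (A g)" "\<And>g. g \<in> SL4 \<Longrightarrow> has_potential D' g (A g)"
  shows "D = D'"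
proof
  fix \<sigma>
  show "D \<sigma> = D' \<sigma>"
  proof (cases "\<sigma> \<in> sections_P")
    case True
    show ?thesis
    proof
      fix g
      show "D \<sigma> g = D' \<sigma> g"
      proof (cases "g \<in> SL4")
        case g: True
        have "\<forall>X. \<sigma> (chart g X) = frame g X *v frame_coords g \<sigma> X"
          using frame_mult_frame_coords [OF g True] by simp
        then show ?thesis
          using pot [OF g] True unfolding has_potential_def by (intro ext) metis
      next
        case False
        have "D \<sigma> \<in> one_forms_P" "D' \<sigma> \<in> one_forms_P"
          using D D' True unfolding connections_P_def by auto
        then show ?thesis
          using False by (auto simp: one_forms_P_def extensional_def)
      qed
    qed
  next
    case False
    then show ?thesis
      using D D' unfolding connections_P_def by (auto simp: PiE_def extensional_def)
  qed
qed

lemma ex1_global_tHooft_map: "\<exists>!\<phi>. global_tHooft_map \<phi>"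
proof (rule ex1I)
  show "global_tHooft_map (\<lambda>s\<in>nonvanishing_sections. tHooft_connection s)"
    by (auto simp: global_tHooft_map_def tHooft_connection_in_connections_P has_potential_tHooft_connection)
next
  fix \<phi> assume \<phi>: "global_tHooft_map \<phi>"
  show "\<phi> = (\<lambda>s\<in>nonvanishing_sections. tHooft_connection s)"
  proof
    fix s
    show "\<phi> s = (\<lambda>s\<in>nonvanishing_sections. tHooft_connection s) s"
    proof (cases "s \<in> nonvanishing_sections")
      case True
      have "\<phi> s = tHooft_connection s"
        using \<phi> True unfolding global_tHooft_map_def
        by (intro connections_P_eqI [where A = "\<lambda>g. tHooft (s g)"] tHooft_connection_in_connections_P
            has_potential_tHooft_connection) auto
      then show ?thesis using True by simp
    next
      case False
      then show ?thesis
        using \<phi> unfolding global_tHooft_map_def by (auto simp: PiE_def extensional_def)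
    qed
  qed
qed

section \<open>Global sections by orthogonal projection, and uniqueness of potentials\<close>

lemma orthogonal_projection_unique:
  fixes w :: "'a::euclidean_space"
  assumes "subspace p" "y \<in> p" "y' \<in> p"
    and "\<And>z. z \<in> p \<Longrightarrow> (w - y) \<bullet> z = 0" "\<And>z. z \<in> p \<Longrightarrow> (w - y') \<bullet> z = 0"
  shows "y = y'"
proof -
  have "y - y' \<in> p" using assms(1-3) by (rule subspace_diff)
  then have "(w - y') \<bullet> (y - y') - (w - y) \<bullet> (y - y') = 0" using assms(4,5) by simp
  then have "(y - y') \<bullet> (y - y') = 0" by (simp add: inner_diff_left)
  then show ?thesis by simp
qed

text \<open>Supplies global sections without cut-off functions. On a plane that already contains
  \<open>w\<close> the value is \<open>w\<close>, which is how values at a point are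
  prescribed.\<close>

definition projection_section :: "real^4 \<Rightarrow> (real^4) set \<Rightarrow> real^4" where
  "projection_section w = (\<lambda>p\<in>Gr. THE y. y \<in> p \<and> (\<forall>z\<in>p. (w - y) \<bullet> z = 0))"

lemma projection_section_eq:
  assumes "p \<in> Gr" "y \<in> p" "\<And>z. z \<in> p \<Longrightarrow> (w - y) \<bullet> z = 0"
  shows "projection_section w p = y"
  unfolding projection_section_def using assms
  by (auto intro!: the_equality orthogonal_projection_unique [OF Gr_subspace])

lemma projection_section_mem:
  assumes "p \<in> Gr"
  shows "projection_section w p \<in> p"
proof -
  obtain y z where "y \<in> span p" "\<And>x. x \<in> span p \<Longrightarrow> orthogonal z x" "w = y + z"
    using orthogonal_subspace_decomp_exists by blast
  moreover have "span p = p" using Gr_subspace [OF assms] by (rule span_eq_iff [THEN iffD2])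
  ultimately have "y \<in> p" "projection_section w p = y"
    using assms by (auto intro!: projection_section_eq simp: orthogonal_def)
  then show ?thesis by simp
qed

text \<open>The normal equations give the coordinates (F^T F)^-1 F^T w. The Gram matrix F^T F is
  invertible because v . (F^T F v) = |F v|^2 and F is injective, so the adjugate formula shows
  smoothness in each chart.\<close>

lemma projection_section_in_sections_P: "projection_section w \<in> sections_P"
proof (rule sections_P_I)
  fix g assume g: "g \<in> SL4"
  let ?F = "frame g"
  let ?M = "\<lambda>X. transpose (?F X) ** ?F X"
  let ?c = "\<lambda>X. (inverse (det (?M X)) *\<^sub>R adj2 (?M X)) *v (transpose (?F X) *v w)"
  have det: "det (?M X) \<noteq> 0" for X
  proof -
    have "v = 0" if "?M X *v v = 0" for v
    proof -
      have "(?F X *v v) \<bullet> (?F X *v v) = v \<bullet> (?M X *v v)"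
        by (metis dot_lmul_matrix inner_commute matrix_vector_mul_assoc vector_transpose_matrix)
      then have "?F X *v v = 0" using that by simp
      then show ?thesis by (rule frame_mult_eq_0 [OF g])
    qed
    then show ?thesis
      by (metis invertible_det_nz invertible_left_inverse matrix_left_invertible_ker)
  qed
  have "bounded_linear (transpose :: real^2^4 \<Rightarrow> real^4^2)"
    unfolding linear_conv_bounded_linear [symmetric]
    by (rule linearI) (simp_all add: transpose_def vec_eq_iff)
  then have "smooth (\<lambda>X. transpose (?F X))"
    by (rule smooth_bounded_linear) (rule smooth_frame)
  moreover from this have M: "smooth ?M"
    by (rule smooth_matrix_mult) (rule smooth_frame)
  ultimately show "smooth ?c"
    by (intro smooth_matrix_vector_mult smooth_scaleR smooth_inverse smooth_det2 det
        smooth_bounded_linear [OF bounded_linear_adj2] smooth_const)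
  fix X
  show "projection_section w (chart g X) = ?F X *v ?c X"
  proof (rule projection_section_eq [OF chart_in_Gr [OF g]])
    show "?F X *v ?c X \<in> chart g X" by (simp add: chart_eq_range)
    have "?M X ** (inverse (det (?M X)) *\<^sub>R adj2 (?M X)) = mat 1"
      using det [of X] by (simp add: bounded_bilinear.scaleR_right [OF bounded_bilinear_matrix_matrix_mult] mult_adj2)
    from arg_cong [OF this, of "\<lambda>N. N *v (transpose (?F X) *v w)"]
    have "?M X *v ?c X = transpose (?F X) *v w"
      by (simp only: matrix_vector_mul_assoc [symmetric] matrix_vector_mul_lid)
    moreover have "transpose (?F X) *v (?F X *v ?c X) = ?M X *v ?c X"
      by (rule matrix_vector_mul_assoc)
    ultimately have *: "transpose (?F X) *v (w - ?F X *v ?c X) = 0"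
      by (simp only: matrix_vector_mult_diff_distrib diff_self)
    fix z assume "z \<in> chart g X"
    then obtain v where "z = ?F X *v v" by (auto simp: chart_eq_range)
    then have "(w - ?F X *v ?c X) \<bullet> z = (transpose (?F X) *v (w - ?F X *v ?c X)) \<bullet> v"
      by (simp only: transpose_matrix_vector dot_lmul_matrix)
    then show "(w - ?F X *v ?c X) \<bullet> z = 0" using * by simp
  qed
qed (auto simp: projection_section_mem, simp add: projection_section_def)

text \<open>Two potentials applied to one section share the derivative term, so they agree on the
  value of the section at the point; a section with arbitrary value there separates them. This is
  what evaluates the definite description in \<open>curvature\<close>.\<close>

lemma has_potential_unique:
  assumes g: "g \<in> SL4" and A: "has_potential D g A" and B: "has_potential D g B"
  shows "A = B"
proof (intro ext)
  fix X Y
  have "A X Y *v c = B X Y *v c" for c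
  proof -
    \<comment> \<open>The projected vector is chosen inside the plane at \<open>X\<close>, so the
      section takes this value there and its coordinates at \<open>X\<close> are
      \<open>c\<close>.\<close>
    let ?\<sigma> = "projection_section (frame g X *v c)"
    let ?v = "frame_coords g ?\<sigma>"
    have "?\<sigma> (chart g X) = frame g X *v c"
      by (rule projection_section_eq [OF chart_in_Gr [OF g]]) (auto simp: chart_eq_range)
    then have c: "?v X = c" by (rule frame_coords_eq [OF g])
    have "\<forall>X. ?\<sigma> (chart g X) = frame g X *v ?v X"
      using frame_mult_frame_coords [OF g projection_section_in_sections_P] by simp
    then have "D ?\<sigma> g X Y = frame g X *v (frechet_derivative ?v (at X) Y + A X Y *v ?v X)"
      "D ?\<sigma> g X Y = frame g X *v (frechet_derivative ?v (at X) Y + B X Y *v ?v X)"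
      using A B projection_section_in_sections_P unfolding has_potential_def by blast+
    then show ?thesis by (simp add: frame_inject [OF g] c)
  qed
  then show "A X Y = B X Y" by (simp add: matrix_eq)
qed

section \<open>Anti-self-duality of the curvature\<close>

lemma det_4:
  "det (A::'a::comm_ring_1^4^4) =
    A$1$1 * (A$2$2 * (A$3$3 * A$4$4 - A$3$4 * A$4$3) - A$2$3 * (A$3$2 * A$4$4 - A$3$4 * A$4$2)
      + A$2$4 * (A$3$2 * A$4$3 - A$3$3 * A$4$2)) -
    A$1$2 * (A$2$1 * (A$3$3 * A$4$4 - A$3$4 * A$4$3) - A$2$3 * (A$3$1 * A$4$4 - A$3$4 * A$4$1)
      + A$2$4 * (A$3$1 * A$4$3 - A$3$3 * A$4$1)) +
    A$1$3 * (A$2$1 * (A$3$2 * A$4$4 - A$3$4 * A$4$2) - A$2$2 * (A$3$1 * A$4$4 - A$3$4 * A$4$1)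
      + A$2$4 * (A$3$1 * A$4$2 - A$3$2 * A$4$1)) -
    A$1$4 * (A$2$1 * (A$3$2 * A$4$3 - A$3$3 * A$4$2) - A$2$2 * (A$3$1 * A$4$3 - A$3$3 * A$4$1)
      + A$2$3 * (A$3$1 * A$4$2 - A$3$2 * A$4$1))"
proof -
  have f: "finite {2::4, 3, 4}" "1 \<notin> {2::4, 3, 4}" "finite {3::4, 4}" "2 \<notin> {3::4, 4}"
    "finite {4::4}" "3 \<notin> {4::4}"
    by auto
  show ?thesis
    unfolding det_def UNIV_4
    unfolding sum_over_permutations_insert[OF f(1,2)]
    unfolding sum_over_permutations_insert[OF f(3,4)]
    unfolding sum_over_permutations_insert[OF f(5,6)]
    unfolding permutes_sing
    by (simp add: sign_swap_id permutation_swap_id permutation_compose sign_compose sign_id swap_id_eq algebra_simps)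
qed

abbreviation E11 :: mat2 where "E11 \<equiv> axis 1 (axis 1 1)"
abbreviation E12 :: mat2 where "E12 \<equiv> axis 1 (axis 2 1)"
abbreviation E21 :: mat2 where "E21 \<equiv> axis 2 (axis 1 1)"
abbreviation E22 :: mat2 where "E22 \<equiv> axis 2 (axis 2 1)"

lemma mat2_expansion: "Y = Y$1$1 *\<^sub>R E11 + Y$1$2 *\<^sub>R E12 + Y$2$1 *\<^sub>R E21 + Y$2$2 *\<^sub>R E22"
  by (simp add: vec_eq_iff forall_2 axis_def)

lemma sum_Basis_mat2: "sum \<phi> (Basis :: mat2 set) = \<phi> E11 + \<phi> E12 + \<phi> E21 + \<phi> E22"
proof -
  have *: "(Basis :: mat2 set) = {E11, E12, E21, E22}"
    unfolding Basis_vec_def UNIV_2 by auto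
  show ?thesis unfolding * by (simp add: axis_eq_axis add.assoc)
qed

lemma sharp_eqI:
  assumes "\<And>V. metric W V = a \<bullet> V"
  shows "sharp a = W"
  unfolding sharp_def
proof (rule the_equality)
  fix W' assume W': "\<forall>V. metric W' V = a \<bullet> V"
  have "metric W' V = metric W V" for V using W' assms by simp
  from this [of E11] this [of E12] this [of E21] this [of E22] show "W' = W"
    by (simp add: metric_def axis_def vec_eq_iff forall_2)
qed (use assms in simp)

lemma sharp_Basis [simp]: "sharp E11 = E22" "sharp E22 = E11" "sharp E12 = - E21" "sharp E21 = - E12"
  by (rule sharp_eqI, simp add: inner_axis', simp add: metric_def axis_def)+

text \<open>The sum is twice the self-dual part of the form. It depends only on the values of the
  form on three self-dual bivectors, so anti-self-duality becomes three scalar conditions. The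
  coefficients are the corresponding self-dual coordinate forms evaluated at \<open>U\<close> and
  \<open>V\<close>.\<close>

lemma hodge_add_self:
  fixes \<omega> :: "mat2 \<Rightarrow> mat2 \<Rightarrow> real"
  assumes bil: "bilinear \<omega>" and alt: "\<And>U V. \<omega> U V = - \<omega> V U"
  shows "hodge \<omega> U V + \<omega> U V =
    2 * (U$1$1 * V$2$1 - U$2$1 * V$1$1) * \<omega> E11 E21 + 2 * (U$1$2 * V$2$2 - U$2$2 * V$1$2) * \<omega> E12 E22
    + (U$1$1 * V$2$2 - U$2$2 * V$1$1 - U$2$1 * V$1$2 + U$1$2 * V$2$1) * (\<omega> E11 E22 - \<omega> E21 E12)"
proof -
  note alts = alt [of E12 E11] alt [of E21 E11] alt [of E22 E11] alt [of E12 E21] alt [of E22 E12] alt [of E22 E21]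
  have diag: "\<omega> Z Z = 0" for Z using alt [of Z Z] by simp
  note bils = bilinear_ladd [OF bil] bilinear_radd [OF bil] bilinear_lmul [OF bil] bilinear_rmul [OF bil]
    bilinear_lneg [OF bil] bilinear_rneg [OF bil]
  have 1: "\<omega> U V = (U$1$1 * V$2$1 - U$2$1 * V$1$1) * \<omega> E11 E21 + (U$1$1 * V$1$2 - U$1$2 * V$1$1) * \<omega> E11 E12
    + (U$1$1 * V$2$2 - U$2$2 * V$1$1) * \<omega> E11 E22 + (U$2$1 * V$1$2 - U$1$2 * V$2$1) * \<omega> E21 E12
    + (U$2$1 * V$2$2 - U$2$2 * V$2$1) * \<omega> E21 E22 + (U$1$2 * V$2$2 - U$2$2 * V$1$2) * \<omega> E12 E22"
    by (subst mat2_expansion [of U], subst mat2_expansion [of V])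
      (simp add: bils diag alts algebra_simps)
  have 2: "hodge \<omega> U V = (U$1$1 * V$2$1 - U$2$1 * V$1$1) * \<omega> E11 E21 - (U$1$1 * V$1$2 - U$1$2 * V$1$1) * \<omega> E11 E12
    - (U$1$1 * V$2$2 - U$2$2 * V$1$1) * \<omega> E21 E12 - (U$2$1 * V$1$2 - U$1$2 * V$2$1) * \<omega> E11 E22
    - (U$2$1 * V$2$2 - U$2$2 * V$2$1) * \<omega> E21 E22 + (U$1$2 * V$2$2 - U$2$2 * V$1$2) * \<omega> E12 E22"
    by (simp add: hodge_def sum_Basis_mat2 vol_def coords_def det_4 axis_def [of 1] axis_def [of 2])
       (simp add: bils diag alts algebra_simps axis_def [symmetric])
  show ?thesis unfolding 1 2 by (simp add: algebra_simps)
qed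

lemma hodge_component:
  "hodge \<omega> U V $ i $ j = hodge (\<lambda>U V. \<omega> U V $ i $ j) U V"
  for \<omega> :: "mat2 \<Rightarrow> mat2 \<Rightarrow> mat2"
  by (simp add: hodge_def)

section \<open>Curvature of the ansatz\<close>

lemma frechet_derivative_dX_grad:
  assumes "smooth f"
  shows "frechet_derivative (dX_grad f) (at X) U $ i $ j = frechet_derivative (partial j i f) (at X) U"
proof -
  have "((\<lambda>X. dX_grad f X $ i $ j) has_derivative
      (\<lambda>U. frechet_derivative (dX_grad f) (at X) U $ i $ j)) (at X)"
    by (intro bounded_linear.has_derivative [OF bounded_linear_vec_nth] smooth_has_derivative
        smooth_dX_grad assms)
  moreover have "(\<lambda>X. dX_grad f X $ i $ j) = partial j i f"
    by (simp add: dX_grad_def fun_eq_iff)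
  ultimately have "(partial j i f has_derivative
      (\<lambda>U. frechet_derivative (dX_grad f) (at X) U $ i $ j)) (at X)" by simp
  from frechet_derivative_eq [OF this] show ?thesis by simp
qed

lemma partial_commute:
  assumes "smooth f"
  shows "partial i j (partial k l f) X = partial k l (partial i j f) X"
  unfolding partial_def by (rule frechet_derivative_commute [OF assms])

lemma frechet_derivative_tHooft:
  assumes f: "smooth f" and nz: "f X \<noteq> 0"
  shows "frechet_derivative (\<lambda>Z. tHooft f Z V) (at X) U =
    (trace (dX_grad f X ** U) / (f X)\<^sup>2) *\<^sub>R (dX_grad f X ** V)
      - (1 / f X) *\<^sub>R (frechet_derivative (dX_grad f) (at X) U ** V)"
proof -
  let ?df = "frechet_derivative f (at X)" and ?H = "frechet_derivative (dX_grad f) (at X)"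
  have "((\<lambda>Z. dX_grad f Z ** V) has_derivative (\<lambda>U. ?H U ** V)) (at X)"
    by (intro bounded_linear.has_derivative [OF bounded_bilinear.bounded_linear_left
          [OF bounded_bilinear_matrix_matrix_mult]] smooth_has_derivative smooth_dX_grad f)
  moreover have "((\<lambda>Z. - inverse (f Z)) has_derivative
      (\<lambda>U. - (- (inverse (f X) * ?df U * inverse (f X))))) (at X)"
    by (intro has_derivative_minus Deriv.has_derivative_inverse nz smooth_has_derivative f)
  ultimately have "((\<lambda>Z. (- inverse (f Z)) *\<^sub>R (dX_grad f Z ** V)) has_derivative
      (\<lambda>U. (- inverse (f X)) *\<^sub>R (?H U ** V)
        + (- (- (inverse (f X) * ?df U * inverse (f X)))) *\<^sub>R (dX_grad f X ** V))) (at X)"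
    by (intro has_derivative_scaleR)
  from frechet_derivative_eq [OF this] show ?thesis
    by (simp add: tHooft_def divide_inverse frechet_derivative_eq_trace [OF smooth_differentiable [OF f]]
        power2_eq_square mult_ac)
qed

text \<open>The two trace terms come from differentiating 1/f, the two triple products from A \<and>
  A, and the last bracket from the second derivatives of \<open>f\<close>.\<close>

lemma curvature_form_tHooft:
  assumes f: "smooth f" and nz: "f X \<noteq> 0"
  defines "P \<equiv> dX_grad f X" and "H \<equiv> frechet_derivative (dX_grad f) (at X)"
  shows "curvature_form (tHooft f) X U V =
    (1 / (f X)\<^sup>2) *\<^sub>R (trace (P ** U) *\<^sub>R (P ** V) - trace (P ** V) *\<^sub>R (P ** U) + P ** U ** (P ** V) - P ** V ** (P ** U))
      - (1 / f X) *\<^sub>R (H U ** V - H V ** U)"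
  unfolding curvature_form_def frechet_derivative_tHooft [OF f nz] P_def H_def
  by (simp add: tHooft_def bounded_bilinear.scaleR_left [OF bounded_bilinear_matrix_matrix_mult]
      bounded_bilinear.scaleR_right [OF bounded_bilinear_matrix_matrix_mult]
      matrix_matrix_mult_uminus algebra_simps power2_eq_square)

text \<open>Linearity in \<open>U\<close> is read off the explicit formula, and linearity in
  \<open>V\<close> follows by antisymmetry. Bilinearity allows the Hodge computation to be applied
  to each matrix entry.\<close>

lemma bilinear_curvature_form_tHooft:
  assumes f: "smooth f" and nz: "f X \<noteq> 0"
  shows "bilinear (curvature_form (tHooft f) X)"
proof -
  let ?F = "curvature_form (tHooft f) X"
  have alt: "?F U V = - ?F V U" for U V
    by (simp add: curvature_form_def)
  have lin: "linear (frechet_derivative (dX_grad f) (at X))"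
    by (rule linear_frechet_derivative_smooth [OF smooth_dX_grad [OF f]])
  have 1: "linear (\<lambda>U. ?F U V)" for V
    by (rule linearI)
      (simp_all add: curvature_form_tHooft [OF f nz] linear_add [OF lin] linear_scale [OF lin]
        matrix_add_ldistrib matrix_matrix_mult_add_left trace_add trace_scaleR
        bounded_bilinear.scaleR_left [OF bounded_bilinear_matrix_matrix_mult]
        bounded_bilinear.scaleR_right [OF bounded_bilinear_matrix_matrix_mult] algebra_simps)
  have "linear (\<lambda>U. - ?F U V)" for V
    by (rule linear_compose_neg [OF 1])
  then have "linear (?F V)" for V
    by (subst alt [abs_def]) simp
  with 1 show ?thesis unfolding bilinear_def by simp
qed

text \<open>These three bivectors span the self-dual ones.  The terms quadratic in the gradient cancel
  on them, and the second-order terms combine to the ultrahyperbolic operator.\<close>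

lemma curvature_form_tHooft_self_dual:
  assumes f: "smooth f" and nz: "f X \<noteq> 0"
  shows "curvature_form (tHooft f) X E11 E21 = (- box_local f X / f X) *\<^sub>R E21"
    and "curvature_form (tHooft f) X E12 E22 = (box_local f X / f X) *\<^sub>R E12"
    and "curvature_form (tHooft f) X E11 E22 - curvature_form (tHooft f) X E21 E12 =
      (box_local f X / f X) *\<^sub>R (E11 - E22)"
proof -
  let ?H = "frechet_derivative (dX_grad f) (at X)"
  have H: "?H (axis k (axis l 1)) $ i $ j = partial k l (partial j i f) X" for i j k l
    by (simp add: frechet_derivative_dX_grad [OF f] partial_def)
  \<comment> \<open>Apart from the ultrahyperbolic operator, the second-order terms are commutators
    of coordinate derivatives, such as d11 d21 - d21 d11, and vanish by symmetry.\<close>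
  note c = partial_commute [OF f, of 2 1 1 1] partial_commute [OF f, of 1 2 2 2]
    partial_commute [OF f, of 2 2 1 1] partial_commute [OF f, of 2 1 1 2]
    partial_commute [OF f, of 2 2 1 2] partial_commute [OF f, of 2 2 2 1] partial_commute [OF f, of 1 2 1 1]
  have ax: "(axis i x :: 'a::zero^2) $ j = (if j = i then x else 0)" for i j x
    by (simp add: axis_def)
  have ax': "(axis i x :: ((real,2) vec,2) vec) $ j = (if j = i then x else 0)" for i j x
    by (simp add: axis_def)
  note s = curvature_form_tHooft [OF f nz] vec_eq_iff forall_2 matrix_matrix_mult_def sum_2 H trace_def
    ax ax' box_local_def
  show "curvature_form (tHooft f) X E11 E21 = (- box_local f X / f X) *\<^sub>R E21"
    using c nz by (simp add: s field_simps)
  show "curvature_form (tHooft f) X E12 E22 = (box_local f X / f X) *\<^sub>R E12"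
    using c nz by (simp add: s field_simps)
  show "curvature_form (tHooft f) X E11 E22 - curvature_form (tHooft f) X E21 E12 =
      (box_local f X / f X) *\<^sub>R (E11 - E22)"
    using c nz by (simp add: s field_simps)
qed

text \<open>The sum of the curvature and its Hodge dual is the ultrahyperbolic operator over
  \<open>f\<close> times a fixed nonzero tensor, so the equivalence already holds at each single
  point.\<close>

lemma tHooft_anti_self_dual_iff:
  assumes f: "smooth f" and nz: "f X \<noteq> 0"
  shows "(\<forall>U V. hodge (curvature_form (tHooft f) X) U V = - curvature_form (tHooft f) X U V)
    \<longleftrightarrow> box_local f X = 0"
proof -
  let ?F = "curvature_form (tHooft f) X"
  have bil: "bilinear (\<lambda>U V. ?F U V $ i $ j)" for i j
    using bilinear_curvature_form_tHooft [OF f nz]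
    by (simp add: bilinear_def linear_iff)
  have alt: "?F U V $ i $ j = - ?F V U $ i $ j" for U V i j
    by (simp add: curvature_form_def)
  have add: "(hodge ?F U V + ?F U V) $ i $ j =
    2 * (U$1$1 * V$2$1 - U$2$1 * V$1$1) * ?F E11 E21 $ i $ j + 2 * (U$1$2 * V$2$2 - U$2$2 * V$1$2) * ?F E12 E22 $ i $ j
    + (U$1$1 * V$2$2 - U$2$2 * V$1$1 - U$2$1 * V$1$2 + U$1$2 * V$2$1) * (?F E11 E22 - ?F E21 E12) $ i $ j" for U V i j
    using hodge_add_self [OF bil alt, of i j U V] by (simp add: hodge_component)
  show ?thesis
  proof
    assume "\<forall>U V. hodge ?F U V = - ?F U V"
    \<comment> \<open>On this pair only the first coefficient in \<open>add\<close> is nonzero, and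
      the (2,1) entry is the one in which \<open>?F E11 E21\<close> is supported.\<close>
    then have "(hodge ?F E11 E21 + ?F E11 E21) $ 2 $ 1 = 0" by simp
    then have "?F E11 E21 $ 2 $ 1 = 0" unfolding add by (simp add: axis_def)
    then show "box_local f X = 0"
      using nz by (simp add: curvature_form_tHooft_self_dual [OF f nz])
  next
    assume "box_local f X = 0"
    then have "(hodge ?F U V + ?F U V) $ i $ j = 0" for U V i j
      unfolding add by (simp add: curvature_form_tHooft_self_dual [OF f nz])
    then have "hodge ?F U V + ?F U V = 0" for U V
      by (simp add: vec_eq_iff)
    then show "\<forall>U V. hodge ?F U V = - ?F U V"
      by (simp add: eq_neg_iff_add_eq_0)
  qed
qed

lemma curvature_eq_curvature_form_tHooft:
  assumes "global_tHooft_map \<phi>" "s \<in> nonvanishing_sections" "g \<in> SL4"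
  shows "curvature (\<phi> s) g = curvature_form (tHooft (s g))"
proof -
  have "has_potential (\<phi> s) g (tHooft (s g))"
    using assms unfolding global_tHooft_map_def by blast
  then have "(THE A. has_potential (\<phi> s) g A) = tHooft (s g)"
    using has_potential_unique [OF assms(3)] by (intro the_equality) auto
  then show ?thesis by (simp add: curvature_def)
qed

lemma box22_eq_zero_section_iff:
  "box22 s = zero_section \<longleftrightarrow> (\<forall>g\<in>SL4. \<forall>X. box_local (s g) X = 0)"
  unfolding box22_def zero_section_def by (auto simp: fun_eq_iff restrict_def)

theorem theorem4p7:
  shows "(\<exists>!\<phi>. global_tHooft_map \<phi>) \<and>
    (\<forall>\<phi>. global_tHooft_map \<phi> \<longrightarrow>
      (\<forall>s\<in>nonvanishing_sections.
        anti_self_dual (curvature (\<phi> s)) \<longleftrightarrow> box22 s = zero_section))"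
proof (intro conjI allI impI ballI ex1_global_tHooft_map)
  fix \<phi> s
  assume \<phi>: "global_tHooft_map \<phi>" and s: "s \<in> nonvanishing_sections"
  have "anti_self_dual (curvature (\<phi> s)) \<longleftrightarrow>
      (\<forall>g\<in>SL4. \<forall>X U V. hodge (curvature_form (tHooft (s g)) X) U V = - curvature_form (tHooft (s g)) X U V)"
    unfolding anti_self_dual_def by (simp add: curvature_eq_curvature_form_tHooft [OF \<phi> s])
  also have "\<dots> \<longleftrightarrow> (\<forall>g\<in>SL4. \<forall>X. box_local (s g) X = 0)"
    using tHooft_anti_self_dual_iff nonvanishing_sections_D(1,2) [OF s] by blast
  also have "\<dots> \<longleftrightarrow> box22 s = zero_section"
    by (simp add: box22_eq_zero_section_iff)
  finally show "anti_self_dual (curvature (\<phi> s)) \<longleftrightarrow> box22 s = zero_section" .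
qed

end
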